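(* Let $k$ be an even non-negative integer, let $\chi$ be an odd primitive Dirichlet character modulo $q$, and let $a,x>0$. Then for every complex $\nu$ with $\Re(\nu)>0$, \begin{align*} \sum_{n=1}^\infty\sigma_{k,\chi}(n)n^{\frac{\nu}{2}}K_\nu(a\sqrt{nx})=& \ \delta_{k} \frac{2^{\nu+1}}{a^{\nu+2}} \Gamma(1+\nu)L(1,\chi)x^{-\frac{\nu}{2}-1}+\frac{(-1)^{\frac{k}{2}}i q^k }{a^\nu 2^{k+2-\nu} \pi^{k+1}} \Gamma(\nu)\tau(\chi) \Gamma(k+1)L(k+1,\bar{\chi})\, x^{-\frac{\nu}{2}}\\ &-\frac{(-1)^{\frac{k}{2}}i a^{\nu}q^{\nu+k} x^{\frac{\nu}{2}} }{2^{3\nu+k+2} \pi^{2\nu+k+1}}\Gamma(\nu+k+1)\tau(\chi) \sum_{n=1}^\infty \frac{ \bar{\sigma}_{k,\bar{\chi}}(n)}{\left( n+\frac{a^2qx}{16\pi^2} \right)^{\nu+k+1} }, \end{align*} where $\delta_k=1$ if $k=0$ and $\delta_k=0$ if $k>0$.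
   Context: For a Dirichlet character $\chi$ and $z\in\mathbb{C}$: $\sigma_{z,\chi}(n)=\sum_{d\mid n}d^z\chi(d)$ and $\bar{\sigma}_{z,\chi}(n)=\sum_{d\mid n}d^z\chi(n/d)$. $\tau(\chi)=\sum_{h=1}^q\chi(h)e^{2\pi i h/q}$ is the Gauss sum, $L(s,\chi)$ the Dirichlet $L$-function, $\bar\chi$ the complex conjugate character, and $K_\nu$ the modified Bessel function of the second kind of order $\nu$. *)

theory Defs
  imports "HOL-Analysis.Analysis"
begin

text \<open>Dirichlet characters modulo q, viewed as functions on the naturals
(they are q-periodic, so this loses nothing).\<close>
definition dirichlet_character :: "nat \<Rightarrow> (nat \<Rightarrow> complex) \<Rightarrow> bool" where
  "dirichlet_character q chi \<longleftrightarrow> q > 0 \<and>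
     (\<forall>m n. chi (m * n) = chi m * chi n) \<and>
     (\<forall>n. chi (n + q) = chi n) \<and>
     (\<forall>n. chi n = 0 \<longleftrightarrow> \<not> coprime n q)"

definition induced_modulus :: "nat \<Rightarrow> (nat \<Rightarrow> complex) \<Rightarrow> nat \<Rightarrow> bool" where
  "induced_modulus q chi d \<longleftrightarrow> d dvd q \<and>
     (\<forall>n. coprime n q \<and> n mod d = 1 mod d \<longrightarrow> chi n = 1)"

definition primitive_character :: "nat \<Rightarrow> (nat \<Rightarrow> complex) \<Rightarrow> bool" where
  "primitive_character q chi \<longleftrightarrow> dirichlet_character q chi \<and>
     (\<forall>d. induced_modulus q chi d \<longrightarrow> d = q)"

text \<open>Odd character: chi(-1) = -1, i.e. chi(q-1) = -1.\<close>
definition odd_character :: "nat \<Rightarrow> (nat \<Rightarrow> complex) \<Rightarrow> bool" where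
  "odd_character q chi \<longleftrightarrow> chi (q - 1) = -1"

definition gauss_sum :: "nat \<Rightarrow> (nat \<Rightarrow> complex) \<Rightarrow> complex" where
  "gauss_sum q chi = (\<Sum>h=1..q. chi h * exp (2 * of_real pi * \<i> * of_nat h / of_nat q))"

text \<open>Dirichlet L-function as the (possibly conditionally convergent) Dirichlet series.\<close>
definition dirichlet_L :: "(nat \<Rightarrow> complex) \<Rightarrow> complex \<Rightarrow> complex" where
  "dirichlet_L chi s = lim (\<lambda>N. \<Sum>n=1..N. chi n / of_nat n powr s)"

definition sigma_chi :: "nat \<Rightarrow> (nat \<Rightarrow> complex) \<Rightarrow> nat \<Rightarrow> complex" where
  "sigma_chi k chi n = (\<Sum>d | d dvd n. of_nat d ^ k * chi d)"

definition sigma_bar_chi :: "nat \<Rightarrow> (nat \<Rightarrow> complex) \<Rightarrow> nat \<Rightarrow> complex" where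
  "sigma_bar_chi k chi n = (\<Sum>d | d dvd n. of_nat d ^ k * chi (n div d))"

text \<open>Modified Bessel function of the second kind, via the integral representation
K_nu(z) = int_0^infty exp(-z cosh t) cosh(nu t) dt (valid for z > 0, all complex nu).\<close>
definition besselK :: "complex \<Rightarrow> real \<Rightarrow> complex" where
  "besselK \<nu> z = integral {0..} (\<lambda>t::real. of_real (exp (- z * cosh t)) * cosh (\<nu> * of_real t))"

end

theory Submission
  imports Defs "HOL-Number_Theory.Number_Theory"
begin

text \<open>Since \<open>K_\<nu>(2*sqrt x)\<close> is \<open>x^(-\<nu>/2)/2\<close> times the integral of \<open>t^(\<nu>-1) * exp (-t - x/t)\<close> over
  \<open>t > 0\<close>, the factor \<open>n^(\<nu>/2)\<close> cancels and the left-hand side becomes an integral of the Lambert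
  series \<open>F(y) = \<Sum>n. sigma_chi k chi n * exp (-n*y)\<close> evaluated at \<open>y = a^2*x/(4*t)\<close>. The series \<open>F\<close>
  is an Eisenstein series of weight \<open>k + 1\<close>: it is a constant, plus a multiple of \<open>1/y\<close> if \<open>k = 0\<close>,
  plus \<open>y^(-k-1)\<close> times the dual series in \<open>exp (-4*pi^2/(q*y))\<close>. Integrating this identity term by
  term leaves Gamma integrals only.

  The transformation of \<open>F\<close> needs only that the coefficients form an odd sequence of period \<open>q\<close>, the
  dual coefficients being their finite Fourier transform; for a primitive character the latter is
  the Gauss sum times the conjugate character. It comes from applying the Lipschitz formula, i.e.
  the reflection formula of the polygamma functions, in each of the two variables of the lattice
  sum of \<open>f l / (l + i*m*v)^(k+1)\<close>, with an interchange of the two summations in between. In weight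
  one this double series converges only conditionally; summation by parts, twice, in the variable
  \<open>l\<close> makes it absolutely convergent.\<close>

section \<open>Periodic sequences and the finite Fourier transform\<close>

locale periodic_seq =
  fixes q :: nat and f :: "nat \<Rightarrow> complex"
  assumes modulus_pos: "q > 0" and periodic: "f (n + q) = f n"
begin

lemma periodic_add_mult: "f (n + j * q) = f n"
proof (induction j)
  case (Suc j)
  have "f (n + Suc j * q) = f ((n + j * q) + q)" by (simp add: algebra_simps)
  thus ?case using Suc by (simp only: periodic)
qed simp

lemma periodic_mod: "f (n mod q) = f n"
  using periodic_add_mult [of "n mod q" "n div q"] by (simp add: mult.commute)

lemma periodic_cong: "[m = n] (mod q) \<Longrightarrow> f m = f n"
  by (metis periodic_mod cong_def)

lemma Bseq_periodic: "Bseq f"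
proof -
  have "range f \<subseteq> f ` {..<q}"
    using modulus_pos by (auto intro!: image_eqI [where f = f, OF periodic_mod [symmetric]])
  hence "finite (range f)" by (rule finite_subset) simp
  thus ?thesis by (simp add: Bseq_eq_bounded finite_imp_bounded)
qed

lemma sum_mult_coprime:
  assumes "coprime a q"
  shows "(\<Sum>h<q. f (h * a)) = (\<Sum>h<q. f h)"
proof -
  have inj: "inj_on (\<lambda>h. h * a mod q) {..<q}"
  proof (rule inj_onI)
    fix h h' assume h: "h \<in> {..<q}" "h' \<in> {..<q}" and "h * a mod q = h' * a mod q"
    hence "[h = h'] (mod q)"
      using assms cong_mult_rcancel_nat [of a q h h'] by (simp add: cong_def coprime_commute)
    thus "h = h'" using h by (simp add: cong_def)
  qed
  moreover have "(\<lambda>h. h * a mod q) ` {..<q} = {..<q}"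
    using modulus_pos by (intro endo_inj_surj inj) auto
  ultimately have "(\<Sum>h<q. f h) = (\<Sum>h<q. f (h * a mod q))"
    using sum.reindex [OF inj, of f] by simp
  thus ?thesis by (simp only: periodic_mod)
qed

end

abbreviation two_pi_i :: complex where
  "two_pi_i \<equiv> 2 * of_real pi * \<i>"

definition unity_exp :: "nat \<Rightarrow> nat \<Rightarrow> complex" where
  "unity_exp q n = exp (two_pi_i * (of_nat n / of_nat q))"

lemma unity_exp_add: "unity_exp q (m + n) = unity_exp q m * unity_exp q n"
  by (simp add: unity_exp_def exp_add [symmetric] ring_distribs add_divide_distrib)

lemma unity_exp_mult: "unity_exp q (m * n) = unity_exp q m ^ n"
  by (simp add: unity_exp_def exp_of_nat_mult [symmetric] mult_ac)

lemma unity_exp_eq_1_iff: "q > 0 \<Longrightarrow> unity_exp q n = 1 \<longleftrightarrow> q dvd n"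
  using complex_root_unity_eq_1 [of q n] by (simp add: unity_exp_def)

lemma periodic_seq_unity_exp: "q > 0 \<Longrightarrow> periodic_seq q (unity_exp q)"
  by unfold_locales (simp_all add: unity_exp_add unity_exp_eq_1_iff)

lemmas unity_exp_cong = periodic_seq.periodic_cong [OF periodic_seq_unity_exp]

lemma sum_unity_exp:
  assumes "q > 0"
  shows "(\<Sum>h<q. unity_exp q (n * h)) = (if q dvd n then of_nat q else 0)"
proof (cases "q dvd n")
  case True
  hence "unity_exp q n = 1" using assms by (simp add: unity_exp_eq_1_iff)
  thus ?thesis using True by (simp add: unity_exp_mult)
next
  case False
  hence "unity_exp q n \<noteq> 1" using assms by (simp add: unity_exp_eq_1_iff)
  moreover have "unity_exp q n ^ q = 1"
    using assms by (simp add: unity_exp_mult [symmetric] unity_exp_eq_1_iff)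
  ultimately show ?thesis using False by (simp add: unity_exp_mult geometric_sum)
qed

definition dft :: "nat \<Rightarrow> (nat \<Rightarrow> complex) \<Rightarrow> nat \<Rightarrow> complex" where
  "dft q f n = (\<Sum>h<q. f h * unity_exp q (h * n))"

lemma periodic_seq_dft:
  assumes "q > 0" shows "periodic_seq q (dft q f)"
proof (unfold_locales, fact)
  fix n
  have "unity_exp q (h * (n + q)) = unity_exp q (h * n)" for h
    using assms by (intro unity_exp_cong) (simp_all add: cong_def algebra_simps)
  thus "dft q f (n + q) = dft q f n" by (simp add: dft_def)
qed

locale odd_periodic_seq = periodic_seq +
  assumes odd: "h \<le> q \<Longrightarrow> f (q - h) = - f h"
begin

lemma odd_periodic_0 [simp]: "f 0 = 0"
  using odd [of 0] periodic [of 0] by simp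

lemma sum_mult_reflect: "(\<Sum>h<q. f h * g (q - h)) = - (\<Sum>h<q. f h * g h)"
proof -
  have split: "{..<q} = insert 0 {1..<q}" using modulus_pos by auto
  have "(\<Sum>h=1..<q. f h * g (q - h)) = (\<Sum>h=1..<q. f (q - h) * g h)"
    by (rule sum.reindex_bij_witness [of _ "\<lambda>h. q - h" "\<lambda>h. q - h"]) auto
  also have "\<dots> = - (\<Sum>h=1..<q. f h * g h)" by (simp add: odd sum_negf)
  finally show ?thesis unfolding split by simp
qed

lemma sum_period_eq_0: "(\<Sum>h<q. f h) = 0"
  using sum_mult_reflect [of "\<lambda>_. 1"] by simp

lemma odd_periodic_seq_cnj: "odd_periodic_seq q (\<lambda>n. cnj (f n))"
  by unfold_locales (simp_all add: modulus_pos periodic odd)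

lemma odd_periodic_seq_dft: "odd_periodic_seq q (dft q f)"
proof -
  interpret dft: periodic_seq q "dft q f" by (rule periodic_seq_dft [OF modulus_pos])
  show ?thesis
  proof
    fix n assume n: "n \<le> q"
    have "unity_exp q (h * (q - n)) = unity_exp q ((q - h) * n)" if "h < q" for h
    proof (rule unity_exp_cong [OF modulus_pos])
      have "h * (q - n) + h * n = h * q" "(q - h) * n + h * n = n * q"
        using n that by (simp_all add: diff_mult_distrib diff_mult_distrib2 mult.commute)
      hence "[h * (q - n) + h * n = (q - h) * n + h * n] (mod q)" by (simp add: cong_def)
      thus "[h * (q - n) = (q - h) * n] (mod q)" by (simp only: cong_add_rcancel_nat)
    qed
    hence "dft q f (q - n) = (\<Sum>h<q. f h * unity_exp q ((q - h) * n))"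
      by (simp add: dft_def)
    thus "dft q f (q - n) = - dft q f n"
      using sum_mult_reflect [of "\<lambda>h. unity_exp q (h * n)"] by (simp add: dft_def)
  qed
qed

lemma dft_dft: "dft q (dft q f) n = - (of_nat q * f n)"
proof -
  have "dft q (dft q f) n = (\<Sum>d<q. \<Sum>h<q. f h * unity_exp q ((h + n) * d))"
    by (simp add: dft_def sum_distrib_left sum_distrib_right unity_exp_add distrib_left mult_ac)
  also have "\<dots> = (\<Sum>h<q. f h * (\<Sum>d<q. unity_exp q ((h + n) * d)))"
    by (subst sum.swap) (simp add: sum_distrib_left)
  also have "\<dots> = (\<Sum>h<q. f h * (if q dvd h + n then of_nat q else 0))"
    by (simp only: sum_unity_exp [OF modulus_pos])
  also have "\<dots> = - (\<Sum>h<q. f h * (if q dvd (q - h) + n then of_nat q else 0))"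
    using sum_mult_reflect [of "\<lambda>h. if q dvd h + n then of_nat q else 0"]
    by (simp add: minus_equation_iff)
  also have "(\<Sum>h<q. f h * (if q dvd (q - h) + n then of_nat q else 0)) =
      (\<Sum>h<q. if h = n mod q then f h * of_nat q else 0)"
  proof (intro sum.cong refl)
    fix h assume "h \<in> {..<q}"
    hence h: "h < q" by simp
    have "q dvd (q - h) + n \<longleftrightarrow> [(q - h) + n = (q - h) + h] (mod q)"
      using h by (simp only: cong_def le_add_diff_inverse2 less_imp_le mod_self dvd_eq_mod_eq_0)
    also have "\<dots> \<longleftrightarrow> [n = h] (mod q)" by (rule cong_add_lcancel_nat)
    also have "\<dots> \<longleftrightarrow> h = n mod q" using h by (auto simp: cong_def)
    finally show "f h * (if q dvd (q - h) + n then of_nat q else 0) =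
        (if h = n mod q then f h * of_nat q else 0)" by simp
  qed
  also have "\<dots> = of_nat q * f n" using modulus_pos by (simp add: periodic_mod)
  finally show ?thesis .
qed

end

section \<open>Primitive characters\<close>

locale dirichlet_char =
  fixes q :: nat and chi :: "nat \<Rightarrow> complex"
  assumes character: "dirichlet_character q chi"
begin

lemma char_mult: "chi (m * n) = chi m * chi n"
  using character by (simp add: dirichlet_character_def)

lemma char_eq_0_iff: "chi n = 0 \<longleftrightarrow> \<not> coprime n q"
  using character by (simp add: dirichlet_character_def)

sublocale periodic_seq q chi
  by unfold_locales (use character in \<open>simp_all add: dirichlet_character_def\<close>)

lemma char_1 [simp]: "chi (Suc 0) = 1"
  using char_mult [of 1 1] char_eq_0_iff [of 1] by auto

lemma norm_char:
  assumes "coprime n q" shows "norm (chi n) = 1"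
proof -
  have "chi (n ^ k) = chi n ^ k" for k by (induction k) (simp_all add: char_mult)
  moreover have "chi (n ^ totient q) = chi 1"
    using assms by (intro periodic_cong euler_theorem)
  ultimately have "chi n ^ totient q = 1" by simp
  thus ?thesis using modulus_pos by (auto dest: power_eq_1_iff)
qed

lemma odd_periodic_seq_char:
  assumes "odd_character q chi" shows "odd_periodic_seq q chi"
proof
  fix h assume h: "h \<le> q"
  have "(q - 1) * h + h = h * q" using modulus_pos by (cases q) simp_all
  hence "[(q - 1) * h + h = (q - h) + h] (mod q)" using h by (simp add: cong_def)
  hence "[(q - 1) * h = q - h] (mod q)" by (simp only: cong_add_rcancel_nat)
  from periodic_cong [OF this] show "chi (q - h) = - chi h"
    using assms by (simp add: char_mult odd_character_def)
qed

lemma gauss_sum_eq_dft: "gauss_sum q chi = dft q chi 1"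
proof -
  have "{1..q} = insert q {1..<q}" "{..<q} = insert 0 {1..<q}" using modulus_pos by auto
  moreover have "chi q = chi 0" using periodic [of 0] by simp
  moreover have "unity_exp q q = unity_exp q 0"
    using periodic_seq.periodic [OF periodic_seq_unity_exp, of q 0] modulus_pos by simp
  moreover have "gauss_sum q chi = (\<Sum>h=1..q. chi h * unity_exp q h)"
    by (simp add: gauss_sum_def unity_exp_def)
  ultimately show ?thesis by (simp add: dft_def)
qed

lemma dft_char_mult:
  assumes "coprime n q" and "[n * d = e] (mod q)"
  shows "chi n * dft q chi e = dft q chi d"
proof -
  interpret twist: periodic_seq q "\<lambda>h. chi h * unity_exp q (h * d)"
  proof
    fix h
    have "unity_exp q ((h + q) * d) = unity_exp q (h * d)"
      using modulus_pos by (intro unity_exp_cong) (simp_all add: cong_def distrib_right)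
    thus "chi (h + q) * unity_exp q ((h + q) * d) = chi h * unity_exp q (h * d)"
      by (simp only: periodic)
  qed (rule modulus_pos)
  have "dft q chi d = (\<Sum>h<q. chi (h * n) * unity_exp q (h * n * d))"
    unfolding dft_def by (rule twist.sum_mult_coprime [OF assms(1), symmetric])
  also have "\<dots> = (\<Sum>h<q. chi (h * n) * unity_exp q (h * e))"
    using modulus_pos assms(2)
    by (intro sum.cong refl arg_cong2 [of _ _ _ _ "(*)"] unity_exp_cong)
      (auto simp: mult.assoc intro: cong_scalar_left)
  finally show ?thesis by (simp add: dft_def char_mult sum_distrib_left mult_ac)
qed

lemma dft_char_coprime:
  assumes "coprime d q" shows "dft q chi d = cnj (chi d) * gauss_sum q chi"
proof -
  have "chi d * dft q chi d = gauss_sum q chi"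
    using dft_char_mult [OF assms, of 1 d] by (simp add: gauss_sum_eq_dft)
  hence "cnj (chi d) * gauss_sum q chi = (chi d * cnj (chi d)) * dft q chi d"
    by (simp add: mult_ac)
  thus ?thesis using norm_char [OF assms] by (simp add: complex_norm_square [symmetric])
qed

end

locale primitive_char = dirichlet_char +
  assumes primitive: "primitive_character q chi"
begin

lemma dft_char_not_coprime:
  assumes "\<not> coprime d q" shows "dft q chi d = 0"
proof -
  define g where "g = gcd d q"
  define q' where "q' = q div g"
  have "g \<noteq> 1" using assms unfolding g_def coprime_iff_gcd_eq_1 .
  moreover have "g \<noteq> 0" using modulus_pos by (simp add: g_def)
  ultimately have "g > 1" by linarith
  have g: "g dvd q" "g dvd d" by (simp_all add: g_def)
  have q': "q = q' * g" using g by (simp add: q'_def)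
  have "q' < q" unfolding q'_def using \<open>g > 1\<close> modulus_pos by (rule div_less_dividend)
  hence "\<not> induced_modulus q chi q'"
    using primitive unfolding primitive_character_def by blast
  moreover have "q' dvd q" unfolding q' by (rule dvd_triv_left)
  ultimately obtain n where n: "coprime n q" "[n = 1] (mod q')" "chi n \<noteq> 1"
    unfolding induced_modulus_def cong_def by blast
  have "[n * d = d] (mod q)"
  proof -
    have "[n * d = 1 * d] (mod q' * d)"
      using n(2) by (metis cong_def mod_mult_mult2)
    moreover have "q dvd q' * d" using q' g(2) by (simp add: mult_dvd_mono)
    ultimately show ?thesis by (auto dest: cong_dvd_modulus_nat)
  qed
  from dft_char_mult [OF n(1) this] show ?thesis using n(3) by simp
qed

theorem dft_primitive_char: "dft q chi = (\<lambda>d. gauss_sum q chi * cnj (chi d))"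
proof
  fix d show "dft q chi d = gauss_sum q chi * cnj (chi d)"
    using char_eq_0_iff [of d] dft_char_coprime [of d] dft_char_not_coprime [of d]
    by (cases "coprime d q") simp_all
qed

end

section \<open>Summation by parts\<close>

lemma sum_Abel:
  fixes D f :: "nat \<Rightarrow> 'a :: comm_ring"
  shows "(\<Sum>n<N. (D (Suc n) - D n) * f n) =
    (\<Sum>n<N. D (Suc n) * (f n - f (Suc n))) + D N * f N - D 0 * f 0"
  by (induction N) (simp_all add: algebra_simps)

lemma sums_Abel:
  fixes D f :: "nat \<Rightarrow> 'a :: real_normed_field"
  assumes "Bseq D" "f \<longlonglongrightarrow> 0" and "(\<lambda>n. D (Suc n) * (f n - f (Suc n))) sums S"
  shows "(\<lambda>n. (D (Suc n) - D n) * f n) sums (S - D 0 * f 0)"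
proof -
  have "(\<lambda>N. D N * f N) \<longlonglongrightarrow> 0"
    using bounded_bilinear.Zfun_prod_Bfun [OF bounded_bilinear_mult, of f _ D] assms(1,2)
    by (simp add: tendsto_Zfun_iff mult.commute)
  with assms(3) have "(\<lambda>N. (\<Sum>n<N. D (Suc n) * (f n - f (Suc n))) + D N * f N - D 0 * f 0)
      \<longlonglongrightarrow> S + 0 - D 0 * f 0"
    unfolding sums_def by (intro tendsto_intros)
  thus ?thesis by (simp add: sums_def sum_Abel)
qed

definition second_difference :: "(nat \<Rightarrow> 'a :: comm_ring_1) \<Rightarrow> nat \<Rightarrow> 'a" where
  "second_difference f n = f n - 2 * f (n + 1) + f (n + 2)"

lemma sums_Abel_twice:
  fixes B f :: "nat \<Rightarrow> 'a :: real_normed_field"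
  assumes "Bseq B" "B 1 = 0" "f \<longlonglongrightarrow> 0"
    and "(\<lambda>n. B (n + 2) * second_difference f n) sums S"
  shows "(\<lambda>n. second_difference B n * f n) sums (S + B 0 * f 0)"
proof -
  define D where "D n = B (Suc n) - B n" for n
  define \<Delta> where "\<Delta> n = f n - f (Suc n)" for n
  have B: "Bseq (\<lambda>n. B (Suc n))" using assms(1) by (simp add: Bseq_Suc_iff)
  obtain K where "\<And>n. norm (B n) \<le> K" using assms(1) unfolding Bseq_def by blast
  hence "norm (D n) \<le> K + K" for n
    unfolding D_def by (intro norm_triangle_le_diff add_mono)
  hence D: "Bseq D" by (rule BseqI')
  have f: "(\<lambda>n. f (Suc n)) \<longlonglongrightarrow> 0" using assms(3) by (rule LIMSEQ_Suc)
  hence \<Delta>: "\<Delta> \<longlonglongrightarrow> 0" unfolding \<Delta>_def using tendsto_diff [OF assms(3) f] by simp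
  have "(\<lambda>n. B (Suc (Suc n)) * (\<Delta> n - \<Delta> (Suc n))) sums S"
    using assms(4) by (simp add: \<Delta>_def second_difference_def algebra_simps)
  from sums_Abel [OF B \<Delta> this] have "(\<lambda>n. D (Suc n) * (f n - f (Suc n))) sums S"
    using assms(2) by (simp add: D_def \<Delta>_def)
  from sums_Abel [OF D assms(3) this] show ?thesis
    using assms(2) by (simp add: D_def second_difference_def algebra_simps)
qed

context periodic_seq
begin

lemma periodic_seq_partial_sum:
  assumes "(\<Sum>h<q. f h) = 0"
  shows "periodic_seq q (\<lambda>n. \<Sum>i<n. f i)"
proof
  fix n
  have "(\<Sum>i<m + n. f i) = (\<Sum>i<m. f i) + (\<Sum>i<n. f (m + i))" for m
    by (induction n) (simp_all add: add_ac)
  from this [of q] show "(\<Sum>i<n + q. f i) = (\<Sum>i<n. f i)"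
    using assms periodic by (simp add: add.commute)
qed (rule modulus_pos)

lemma periodic_seq_add_const: "periodic_seq q (\<lambda>n. f n + c)"
  by unfold_locales (simp_all add: modulus_pos periodic)

lemma periodic_eq_second_difference:
  assumes "(\<Sum>h<q. f h) = 0"
  obtains B where "Bseq B" "B 1 = 0" "f = second_difference B"
proof -
  define \<mu> where "\<mu> = (\<Sum>n<q. \<Sum>i<n. f i) / of_nat q"
  define D where "D n = (\<Sum>i<n. f i) + - \<mu>" for n
  interpret D: periodic_seq q D
    unfolding D_def
    by (rule periodic_seq.periodic_seq_add_const [OF periodic_seq_partial_sum [OF assms]])
  have "(\<Sum>n<q. D n) = 0" using modulus_pos
    by (simp add: D_def \<mu>_def sum.distrib sum_negf sum_subtractf)
  define B where "B n = (\<Sum>i<n. D i) + \<mu>" for n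
  interpret B: periodic_seq q B
    unfolding B_def
    by (rule periodic_seq.periodic_seq_add_const [OF D.periodic_seq_partial_sum]) fact
  show ?thesis
  proof
    show "Bseq B" by (rule B.Bseq_periodic)
    show "B 1 = 0" by (simp add: B_def D_def)
    show "f = second_difference B" by (simp add: second_difference_def B_def D_def fun_eq_iff)
  qed
qed

end

section \<open>Double series\<close>

lemma summable_Suc_powr: "e < -1 \<Longrightarrow> summable (\<lambda>n. real (Suc n) powr e)"
  using summable_real_powr_iff [of e] by (subst summable_Suc_iff) simp

lemma summable_on_prodI:
  fixes f :: "nat \<Rightarrow> nat \<Rightarrow> 'a :: banach" and p r :: "nat \<Rightarrow> real"
  assumes "summable p" "summable r" "\<And>i. p i \<ge> 0" "\<And>j. r j \<ge> 0"
    and bound: "\<And>i j. norm (f i j) \<le> p i * r j"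
  shows "(\<lambda>(i, j). f i j) summable_on UNIV"
proof (rule abs_summable_summable, rule Infinite_Sum.abs_summable_on_comparison_test')
  have p: "p summable_on UNIV" and r: "r summable_on UNIV"
    using assms by (simp_all add: summable_on_UNIV_nonneg_real_iff)
  have "(\<lambda>(i, j). p i * r j) summable_on UNIV \<times> UNIV"
  proof (rule summable_on_SigmaI)
    show "((\<lambda>j. case (i, j) of (i, j) \<Rightarrow> p i * r j) has_sum (p i * infsum r UNIV)) UNIV" for i
      using r by (simp add: has_sum_cmult_right)
    show "(\<lambda>i. p i * infsum r UNIV) summable_on UNIV"
      using p by (rule summable_on_cmult_left)
  qed (use assms in auto)
  thus "(\<lambda>(i, j). p i * r j) summable_on UNIV" by simp
qed (auto simp: bound)

lemma has_sum_rows_imp_sums: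
  fixes f :: "nat \<Rightarrow> nat \<Rightarrow> complex"
  assumes "((\<lambda>(i, j). f i j) has_sum S) UNIV"
  shows "summable (f i)" and "(\<lambda>i. \<Sum>j. f i j) sums S"
proof -
  have S: "((\<lambda>(i, j). f i j) has_sum S) (UNIV \<times> UNIV)" using assms by simp
  hence "(\<lambda>(i, j). f i j) summable_on UNIV \<times> UNIV" by (rule has_sum_imp_summable)
  hence row: "f i summable_on UNIV" for i
    using summable_on_SigmaD1 [where f = f and A = UNIV and B = "\<lambda>_. UNIV"] by simp
  thus summable: "summable (f i)" for i by (rule summable_on_imp_summable)
  have "infsum (f i) UNIV = (\<Sum>j. f i j)" for i
    using has_sum_imp_sums [OF has_sum_infsum [OF row]] by (rule sums_unique)
  with has_sum_infsum [OF row] have "(f i has_sum (\<Sum>j. f i j)) UNIV" for i by metis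
  from has_sum_SigmaD [OF S, of "\<lambda>i. \<Sum>j. f i j"] this show "(\<lambda>i. \<Sum>j. f i j) sums S"
    by (intro has_sum_imp_sums) simp
qed

lemma has_sum_columns_imp_sums:
  fixes f :: "nat \<Rightarrow> nat \<Rightarrow> complex"
  assumes "((\<lambda>(i, j). f i j) has_sum S) UNIV"
  shows "summable (\<lambda>i. f i j)" and "(\<lambda>j. \<Sum>i. f i j) sums S"
proof -
  have "((\<lambda>(i, j). f j i) has_sum S) UNIV"
    using assms has_sum_swap [where f = "\<lambda>(i, j). f i j" and A = UNIV and B = UNIV] by simp
  from has_sum_rows_imp_sums [OF this]
  show "summable (\<lambda>i. f i j)" and "(\<lambda>j. \<Sum>i. f i j) sums S" .
qed

lemma has_sum_divisors_imp_sums: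
  fixes f :: "nat \<Rightarrow> nat \<Rightarrow> 'a :: real_normed_vector"
  assumes "((\<lambda>(i, j). f (Suc i) (Suc j)) has_sum S) UNIV"
  shows "(\<lambda>n. \<Sum>d | d dvd Suc n. f d (Suc n div d)) sums S"
proof (rule has_sum_imp_sums, rule has_sum_SigmaD)
  let ?D = "Sigma UNIV (\<lambda>n. {d. d dvd Suc n})"
  have "((\<lambda>(n, d). f d (Suc n div d)) has_sum S) ?D \<longleftrightarrow>
      ((\<lambda>(i, j). f (Suc i) (Suc j)) has_sum S) UNIV"
  proof (rule has_sum_reindex_bij_witness
      [where j = "\<lambda>(n, d). (d - 1, Suc n div d - 1)" and i = "\<lambda>(i, j). (Suc i * Suc j - 1, Suc i)"])
    fix x assume "x \<in> ?D"
    then obtain n d e where x: "x = (n, d)" "Suc n = d * e" by (cases x) (auto simp: dvd_def)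
    hence "d > 0" "e > 0" by (metis nat_0_less_mult_iff zero_less_Suc)+
    with x show "(case case x of (n, d) \<Rightarrow> (d - 1, Suc n div d - 1) of
        (i, j) \<Rightarrow> (Suc i * Suc j - 1, Suc i)) = x"
      "(case case x of (n, d) \<Rightarrow> (d - 1, Suc n div d - 1) of (i, j) \<Rightarrow> f (Suc i) (Suc j)) =
       (case x of (n, d) \<Rightarrow> f d (Suc n div d))"
      by (simp_all del: mult_Suc mult_Suc_right)
  next
    fix y :: "nat \<times> nat"
    obtain i j where y: "y = (i, j)" by (cases y)
    have "Suc (Suc i * Suc j - 1) = Suc i * Suc j" by simp
    with y show "(case case y of (i, j) \<Rightarrow> (Suc i * Suc j - 1, Suc i) of
        (n, d) \<Rightarrow> (d - 1, Suc n div d - 1)) = y"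
      and "(case y of (i, j) \<Rightarrow> (Suc i * Suc j - 1, Suc i)) \<in> ?D"
      by (simp_all del: mult_Suc mult_Suc_right)
  qed simp_all
  with assms show "((\<lambda>(n, d). f d (Suc n div d)) has_sum S) ?D" by simp
qed (auto intro!: has_sum_finite)

section \<open>Lambert series\<close>

lemma exp_minus_le_powr:
  fixes u p :: real
  assumes "u > 0" "p > 0"
  shows "exp (- u) \<le> p powr p * u powr (- p)"
proof -
  have "ln (u / p) \<le> u / p" using ln_le_minus_one [of "u / p"] assms by simp
  hence "p * (ln u - ln p) \<le> u" using assms by (simp add: ln_div field_simps)
  hence "exp (- u) \<le> exp (p * ln p + - p * ln u)" by (simp add: algebra_simps)
  thus ?thesis unfolding exp_add using assms by (simp add: powr_def)
qed

lemma summable_on_divisor_weight: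
  fixes p :: real
  assumes "p > real k + 1"
  shows "(\<lambda>(i, j). real (Suc i) ^ k * (real (Suc i) * real (Suc j)) powr (- p)) summable_on UNIV"
proof (rule summable_on_prodI)
  show "summable (\<lambda>i. real (Suc i) powr (real k - p))" "summable (\<lambda>j. real (Suc j) powr (- p))"
    using assms by (intro summable_Suc_powr; simp)+
  have "x ^ k * (x * y) powr (- p) = x powr (real k - p) * y powr (- p)" if "x > 0" "y > 0"
      for x y :: real
    using that by (simp add: powr_mult powr_diff powr_minus powr_realpow divide_inverse)
  thus "norm (real (Suc i) ^ k * (real (Suc i) * real (Suc j)) powr (- p)) \<le>
      real (Suc i) powr (real k - p) * real (Suc j) powr (- p)" for i j
    by (simp del: of_nat_Suc)
qed simp_all

definition divisor_sum :: "nat \<Rightarrow> (nat \<Rightarrow> complex) \<Rightarrow> (nat \<Rightarrow> complex) \<Rightarrow> nat \<Rightarrow> complex" where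
  "divisor_sum k a b n = (\<Sum>d | d dvd n. of_nat d ^ k * a d * b (n div d))"

lemma sigma_chi_eq_divisor_sum: "sigma_chi k chi = divisor_sum k chi (\<lambda>_. 1)"
  by (simp add: sigma_chi_def divisor_sum_def fun_eq_iff)

lemma sigma_bar_chi_eq_divisor_sum: "sigma_bar_chi k chi = divisor_sum k (\<lambda>_. 1) chi"
  by (simp add: sigma_bar_chi_def divisor_sum_def fun_eq_iff)

lemma divisor_sum_cmult_left: "divisor_sum k (\<lambda>n. c * a n) b n = c * divisor_sum k a b n"
  by (simp add: divisor_sum_def sum_distrib_left mult_ac)

lemma divisor_sum_cmult_right: "divisor_sum k a (\<lambda>n. c * b n) n = c * divisor_sum k a b n"
  by (simp add: divisor_sum_def sum_distrib_left mult_ac)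

lemma divisor_sum_0_commute: "n > 0 \<Longrightarrow> divisor_sum 0 a b n = divisor_sum 0 b a n"
  unfolding divisor_sum_def
  by (rule sum.reindex_bij_witness [of _ "\<lambda>d. n div d" "\<lambda>d. n div d"]) (auto elim!: dvdE)

lemma summable_norm_divisor_sum_powr:
  assumes "Bseq a" "Bseq b" "p > real k + 1"
  shows "summable (\<lambda>n. norm (divisor_sum k a b (Suc n)) * real (Suc n) powr (- p))"
proof -
  obtain A where A: "A > 0" "\<And>n. norm (a n) \<le> A" using assms(1) unfolding Bseq_def by blast
  obtain B where B: "B > 0" "\<And>n. norm (b n) \<le> B" using assms(2) unfolding Bseq_def by blast
  define w where "w d e = real d ^ k * (real d * real e) powr (- p)" for d e :: nat
  obtain S where "((\<lambda>(i, j). w (Suc i) (Suc j)) has_sum S) UNIV"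
    using summable_on_divisor_weight [OF assms(3)] unfolding w_def summable_on_def by blast
  from has_sum_divisors_imp_sums [OF this]
  have "summable (\<lambda>n. A * B * (\<Sum>d | d dvd Suc n. w d (Suc n div d)))"
    by (intro summable_mult sums_summable)
  moreover have "norm (divisor_sum k a b (Suc n)) * real (Suc n) powr (- p) \<le>
      A * B * (\<Sum>d | d dvd Suc n. w d (Suc n div d))" for n
  proof -
    have "norm (divisor_sum k a b (Suc n)) \<le> (\<Sum>d | d dvd Suc n. real d ^ k * A * B)"
      unfolding divisor_sum_def using A B
      by (intro sum_norm_le) (auto simp: norm_mult norm_power intro!: mult_mono)
    hence "norm (divisor_sum k a b (Suc n)) * real (Suc n) powr (- p) \<le>
        (\<Sum>d | d dvd Suc n. real d ^ k * A * B) * real (Suc n) powr (- p)"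
      by (rule mult_right_mono) simp
    also have "\<dots> = A * B * (\<Sum>d | d dvd Suc n. w d (Suc n div d))"
      unfolding sum_distrib_left sum_distrib_right
    proof (intro sum.cong refl)
      fix d assume "d \<in> {d. d dvd Suc n}"
      hence "real d * real (Suc n div d) = real (Suc n)" by (simp flip: of_nat_mult)
      thus "real d ^ k * A * B * real (Suc n) powr (- p) = A * B * w d (Suc n div d)"
        by (simp add: w_def)
    qed
    finally show ?thesis .
  qed
  hence "norm (norm (divisor_sum k a b (Suc n)) * real (Suc n) powr (- p)) \<le>
      A * B * (\<Sum>d | d dvd Suc n. w d (Suc n div d))" for n
    by simp
  ultimately show ?thesis by (rule summable_comparison_test')
qed

definition lambert_series :: "nat \<Rightarrow> (nat \<Rightarrow> complex) \<Rightarrow> (nat \<Rightarrow> complex) \<Rightarrow> real \<Rightarrow> complex" where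
  "lambert_series k a b y = (\<Sum>n. divisor_sum k a b (Suc n) * of_real (exp (- (real (Suc n) * y))))"

lemma summable_on_lambert_terms:
  assumes "Bseq a" "Bseq b" "y > 0"
  shows "(\<lambda>(i, j). of_nat (Suc i) ^ k * a (Suc i) * b (Suc j) *
      complex_of_real (exp (- (real (Suc i) * real (Suc j) * y)))) summable_on UNIV"
proof -
  obtain A where A: "A > 0" "\<And>n. norm (a n) \<le> A" using assms(1) unfolding Bseq_def by blast
  obtain B where B: "B > 0" "\<And>n. norm (b n) \<le> B" using assms(2) unfolding Bseq_def by blast
  define p where "p = real k + 2"
  define C where "C = A * B * (p powr p * y powr (- p))"
  have "norm (of_nat d ^ k * a d * b e * complex_of_real (exp (- (real d * real e * y)))) \<le>
      C * (real d ^ k * (real d * real e) powr (- p))" if "d > 0" "e > 0" for d e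
  proof -
    have "norm (of_nat d ^ k * a d * b e * complex_of_real (exp (- (real d * real e * y)))) =
        real d ^ k * norm (a d) * norm (b e) * exp (- (real d * real e * y))"
      by (simp add: norm_mult norm_power)
    also have "\<dots> \<le> real d ^ k * A * B * (p powr p * (real d * real e * y) powr (- p))"
      using A B assms(3) that
      by (intro mult_mono exp_minus_le_powr mult_nonneg_nonneg) (simp_all add: p_def less_imp_le)
    also have "\<dots> = C * (real d ^ k * (real d * real e) powr (- p))"
      unfolding C_def powr_mult by (simp only: mult_ac)
    finally show ?thesis .
  qed
  hence bound: "norm (case x of (i, j) \<Rightarrow> of_nat (Suc i) ^ k * a (Suc i) * b (Suc j) *
        complex_of_real (exp (- (real (Suc i) * real (Suc j) * y)))) \<le>
      C * (case x of (i, j) \<Rightarrow> real (Suc i) ^ k * (real (Suc i) * real (Suc j)) powr (- p))" for x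
    by (cases x) (simp del: of_nat_Suc)
  have "(\<lambda>x. C * (case x of (i, j) \<Rightarrow> real (Suc i) ^ k * (real (Suc i) * real (Suc j)) powr (- p)))
      summable_on UNIV"
    by (rule summable_on_cmult_right, rule summable_on_divisor_weight) (simp add: p_def)
  from abs_summable_summable [OF Infinite_Sum.abs_summable_on_comparison_test' [OF this bound]]
  show ?thesis .
qed

lemma lambert_series_has_sum:
  assumes "Bseq a" "Bseq b" "y > 0"
  shows "((\<lambda>(i, j). of_nat (Suc i) ^ k * a (Suc i) * b (Suc j) *
      of_real (exp (- (real (Suc i) * real (Suc j) * y)))) has_sum lambert_series k a b y) UNIV"
    and "(\<lambda>n. divisor_sum k a b (Suc n) * of_real (exp (- (real (Suc n) * y)))) sums
      lambert_series k a b y"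
proof -
  define w where "w d e = of_nat d ^ k * a d * b e
      * complex_of_real (exp (- (real d * real e * y)))"
    for d e
  obtain S where S: "((\<lambda>(i, j). w (Suc i) (Suc j)) has_sum S) UNIV"
    using summable_on_lambert_terms [OF assms, of k] unfolding w_def summable_on_def by blast
  have "(\<Sum>d | d dvd Suc n. w d (Suc n div d)) =
      divisor_sum k a b (Suc n) * of_real (exp (- (real (Suc n) * y)))" for n
    unfolding divisor_sum_def sum_distrib_right
  proof (intro sum.cong refl)
    fix d assume "d \<in> {d. d dvd Suc n}"
    hence "real d * real (Suc n div d) = real (Suc n)" by (simp flip: of_nat_mult)
    thus "w d (Suc n div d) =
        of_nat d ^ k * a d * b (Suc n div d) * of_real (exp (- (real (Suc n) * y)))"
      by (simp only: w_def)
  qed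
  with has_sum_divisors_imp_sums [OF S]
  have sums: "(\<lambda>n. divisor_sum k a b (Suc n) * of_real (exp (- (real (Suc n) * y)))) sums S" by simp
  hence "S = lambert_series k a b y" by (simp add: lambert_series_def sums_iff)
  with S sums show "((\<lambda>(i, j). of_nat (Suc i) ^ k * a (Suc i) * b (Suc j) *
      of_real (exp (- (real (Suc i) * real (Suc j) * y)))) has_sum lambert_series k a b y) UNIV"
    and "(\<lambda>n. divisor_sum k a b (Suc n) * of_real (exp (- (real (Suc n) * y)))) sums
      lambert_series k a b y"
    by (simp_all add: w_def)
qed

lemma lambert_series_column_sums:
  assumes "Bseq a" "Bseq b" "y > 0"
  shows "(\<lambda>j. b (Suc j) * (\<Sum>i. of_nat (Suc i) ^ k * a (Suc i) *
      of_real (exp (- (real (Suc i) * (real (Suc j) * y)))))) sums lambert_series k a b y"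
proof -
  have "summable (\<lambda>i. of_nat (Suc i) ^ k * a (Suc i)
      * complex_of_real (exp (- (real (Suc i) * (real (Suc j) * y)))))" for j
    using has_sum_columns_imp_sums(1)
      [OF lambert_series_has_sum(1) [OF assms(1) _ assms(3), of "\<lambda>_. 1" k], of j]
    by (simp add: mult.assoc)
  hence "b (Suc j) * (\<Sum>i. of_nat (Suc i) ^ k * a (Suc i)
      * complex_of_real (exp (- (real (Suc i) * (real (Suc j) * y))))) =
      (\<Sum>i. of_nat (Suc i) ^ k * a (Suc i) * b (Suc j)
        * of_real (exp (- (real (Suc i) * real (Suc j) * y))))" for j
    by (subst suminf_mult [symmetric])
      (simp_all only: mult.assoc mult.left_commute [of "b (Suc j)"])
  with has_sum_columns_imp_sums(2) [OF lambert_series_has_sum(1) [OF assms, of k]]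
  show ?thesis by (simp only:)
qed

lemma lambert_series_cmult_left:
  assumes "Bseq a" "Bseq b" "y > 0"
  shows "lambert_series k (\<lambda>n. c * a n) b y = c * lambert_series k a b y"
  using sums_mult [OF lambert_series_has_sum(2) [OF assms, of k], of c]
  by (simp add: lambert_series_def divisor_sum_cmult_left mult.assoc sums_iff)

lemma lambert_series_0_commute: "lambert_series 0 a b = lambert_series 0 b a"
  by (simp add: lambert_series_def fun_eq_iff divisor_sum_0_commute [of _ a])

section \<open>The Lipschitz summation formula\<close>

lemma summable_of_nat_power_mult:
  fixes w :: "'a :: {banach, real_normed_field}"
  assumes "norm w < 1"
  shows "summable (\<lambda>n. of_nat n ^ k * w ^ n)"
  using assms
proof (induction k arbitrary: w)
  case 0
  thus ?case by (simp add: summable_geometric)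
next
  case (Suc k)
  have "summable (\<lambda>n. diffs (\<lambda>n. of_nat n ^ k) n * w ^ n)"
    by (rule termdiff_converges [OF Suc.prems Suc.IH])
  hence "summable (\<lambda>n. diffs (\<lambda>n. of_nat n ^ k) n * w ^ n * w)"
    by (rule summable_mult2)
  hence "summable (\<lambda>n. of_nat (Suc n) ^ Suc k * w ^ Suc n)"
    by (simp add: diffs_def mult_ac)
  thus ?case by (subst (asm) summable_Suc_iff)
qed

definition polylog_neg :: "nat \<Rightarrow> complex \<Rightarrow> complex" where
  "polylog_neg k w = (\<Sum>d. of_nat (Suc d) ^ k * w ^ Suc d)"

lemma polylog_neg_sums:
  assumes "norm w < 1"
  shows "(\<lambda>d. of_nat (Suc d) ^ k * w ^ Suc d) sums polylog_neg k w"
  using summable_of_nat_power_mult [OF assms, of k]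
  unfolding polylog_neg_def by (intro summable_sums) (subst summable_Suc_iff)

lemma polylog_neg_0:
  assumes "norm w < 1" shows "polylog_neg 0 w = w / (1 - w)"
proof -
  have "(\<lambda>d. w * w ^ d) sums (w * (1 / (1 - w)))"
    by (intro sums_mult geometric_sums assms)
  moreover have "(\<lambda>d. w * w ^ d) sums polylog_neg 0 w"
    using polylog_neg_sums [OF assms, of 0] by simp
  ultimately show ?thesis using sums_unique2 by fastforce
qed

lemma polylog_neg_eq_mult:
  assumes "norm w < 1"
  shows "polylog_neg k w = (\<Sum>n. of_nat (Suc n) ^ k * w ^ n) * w"
proof (cases "w = 0")
  case False
  have "(\<lambda>n. of_nat (Suc n) ^ k * w ^ n * w) sums polylog_neg k w"
    using polylog_neg_sums [OF assms, of k] by (simp add: mult_ac)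
  from sums_divide [OF this, of w]
  have "(\<lambda>n. of_nat (Suc n) ^ k * w ^ n) sums (polylog_neg k w / w)"
    using False by simp
  thus ?thesis using False by (simp add: sums_iff)
qed (simp add: polylog_neg_def)

lemma has_field_derivative_polylog_neg:
  assumes "norm w < 1"
  shows "(polylog_neg k has_field_derivative (\<Sum>n. of_nat (Suc n) ^ Suc k * w ^ n)) (at w)"
proof -
  define c where "c n = (if n = 0 then 0 else of_nat n ^ k :: complex)" for n
  have c_sums: "(\<lambda>n. c n * v ^ n) sums polylog_neg k v" if "norm v < 1" for v
    using polylog_neg_sums [OF that, of k] sums_Suc [of "\<lambda>n. c n * v ^ n"] by (simp add: c_def)
  have "((\<lambda>v. \<Sum>n. c n * v ^ n) has_field_derivative (\<Sum>n. diffs c n * w ^ n)) (at w)"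
    using c_sums by (intro termdiffs_strong' [of 1]) (auto intro: sums_summable assms)
  also have "diffs c = (\<lambda>n. of_nat (Suc n) ^ Suc k)"
    by (simp add: c_def diffs_def fun_eq_iff)
  also have "((\<lambda>v. \<Sum>n. c n * v ^ n) has_field_derivative
      (\<Sum>n. of_nat (Suc n) ^ Suc k * w ^ n)) (at w)
      \<longleftrightarrow> ?thesis"
  proof (rule DERIV_cong_ev [OF refl _ refl])
    show "\<forall>\<^sub>F v in nhds w. (\<Sum>n. c n * v ^ n) = polylog_neg k v"
      using eventually_nhds_in_open [of "ball 0 1" w] assms
      by (auto elim!: eventually_mono intro: sums_unique [symmetric] c_sums)
  qed
  finally show ?thesis .
qed

lemma tendsto_polylog_neg_0: "(polylog_neg k \<longlongrightarrow> 0) (at 0)"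
  using DERIV_isCont [OF has_field_derivative_polylog_neg [of 0 k]]
  by (simp add: isCont_def polylog_neg_def)

lemma has_field_derivative_polylog_neg_exp:
  assumes "Im z > 0"
  shows "((\<lambda>z. polylog_neg k (exp (two_pi_i * z))) has_field_derivative
    two_pi_i * polylog_neg (Suc k) (exp (two_pi_i * z))) (at z)"
proof -
  define w where "w = exp (two_pi_i * z)"
  have w: "norm w < 1" using assms by (simp add: w_def)
  have "((\<lambda>z. exp (two_pi_i * z)) has_field_derivative w * two_pi_i) (at z)"
    unfolding w_def by (auto intro!: derivative_eq_intros)
  with has_field_derivative_polylog_neg [OF w]
  have "((\<lambda>z. polylog_neg k (exp (two_pi_i * z))) has_field_derivative
      (\<Sum>n. of_nat (Suc n) ^ Suc k * w ^ n) * (w * two_pi_i)) (at z)"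
    unfolding w_def by (rule DERIV_chain2)
  thus ?thesis
    unfolding w_def [symmetric] polylog_neg_eq_mult [OF w] by (simp only: mult_ac)
qed

lemma not_nonpos_Int_if_Im_nonzero: "Im z \<noteq> 0 \<Longrightarrow> z \<notin> \<int>\<^sub>\<le>\<^sub>0"
  by (auto elim!: nonpos_Ints_cases)

lemma Digamma_reflection:
  assumes "Im z \<noteq> 0"
  shows "Digamma (1 - z) - Digamma z = of_real pi * cot (of_real pi * z)"
proof -
  have nonpos: "z \<notin> \<int>\<^sub>\<le>\<^sub>0" "1 - z \<notin> \<int>\<^sub>\<le>\<^sub>0"
    using assms by (simp_all add: not_nonpos_Int_if_Im_nonzero)
  have sin: "sin (of_real pi * z) \<noteq> 0"
  proof
    assume "sin (of_real pi * z) = 0"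
    then obtain n :: int where "of_real pi * z = of_real (of_int n * pi)" by (auto simp: sin_eq_0)
    from arg_cong [OF this, of Im] show False using assms by simp
  qed
  have "((\<lambda>z. Gamma z * Gamma (1 - z)) has_field_derivative
      Gamma z * Gamma (1 - z) * (Digamma z - Digamma (1 - z))) (at z)"
    using nonpos by (auto intro!: derivative_eq_intros simp: algebra_simps)
  moreover have "((\<lambda>z. of_real pi / sin (of_real pi * z)) has_field_derivative
      of_real pi / sin (of_real pi * z) * (- (of_real pi * cot (of_real pi * z)))) (at z)"
    using sin by (auto intro!: derivative_eq_intros simp: cot_def field_simps power2_eq_square)
  ultimately have "Gamma z * Gamma (1 - z) * (Digamma z - Digamma (1 - z)) =
      Gamma z * Gamma (1 - z) * (- (of_real pi * cot (of_real pi * z)))"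
    unfolding Gamma_reflection_complex by (rule DERIV_unique)
  moreover have "Gamma z * Gamma (1 - z) \<noteq> 0" using nonpos by (simp add: Gamma_eq_zero_iff)
  ultimately have "Digamma z - Digamma (1 - z) = - (of_real pi * cot (of_real pi * z))"
    by (metis mult_left_cancel)
  thus ?thesis by (simp add: algebra_simps)
qed

lemma cot_eq_polylog_neg:
  assumes "Im z > 0"
  shows "of_real pi * cot (of_real pi * z) =
    - of_real pi * \<i> - two_pi_i * polylog_neg 0 (exp (two_pi_i * z))"
proof -
  define u where "u = exp (\<i> * (of_real pi * z))"
  define w where "w = exp (two_pi_i * z)"
  have w: "norm w < 1" using assms by (simp add: w_def)
  hence w_neq_1: "w \<noteq> 1" by auto
  have u: "u \<noteq> 0" "w = u * u" by (simp_all add: u_def w_def exp_add [symmetric] algebra_simps)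
  have exp_minus_eq: "exp (- (\<i> * (of_real pi * z))) = 1 / u"
    by (simp add: u_def exp_minus field_simps)
  have "cot (of_real pi * z) = \<i> * (u * u + 1) / (u * u - 1)"
    using u w_neq_1 unfolding cot_def cos_exp_eq sin_exp_eq exp_minus_eq u_def [symmetric]
    by (simp add: field_simps)
  also have "\<dots> = - \<i> - 2 * \<i> * (w / (1 - w))"
    using w_neq_1 unfolding u(2) [symmetric] by (simp add: divide_simps) (simp add: algebra_simps)
  finally have "cot (of_real pi * z) = - \<i> - 2 * \<i> * polylog_neg 0 w"
    using w by (simp add: polylog_neg_0)
  thus ?thesis unfolding w_def by (simp only: right_diff_distrib) simp
qed

lemma Polygamma_reflection:
  assumes "Im z > 0"
  shows "(-1) ^ k * Polygamma k (1 - z) - Polygamma k z =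
    (if k = 0 then - of_real pi * \<i> else 0)
    - two_pi_i ^ Suc k * polylog_neg k (exp (two_pi_i * z))"
  using assms
proof (induction k arbitrary: z)
  case 0
  thus ?case using Digamma_reflection [of z] cot_eq_polylog_neg [of z] by simp
next
  case (Suc k)
  let ?l = "\<lambda>z. (-1) ^ k * Polygamma k (1 - z) - Polygamma k z"
  let ?r = "\<lambda>z. (if k = 0 then - of_real pi * \<i> else 0)
      - two_pi_i ^ Suc k * polylog_neg k (exp (two_pi_i * z))"
  have "z \<notin> \<int>\<^sub>\<le>\<^sub>0" "1 - z \<notin> \<int>\<^sub>\<le>\<^sub>0"
    using Suc.prems by (simp_all add: not_nonpos_Int_if_Im_nonzero)
  hence left: "(?l has_field_derivative
      (-1) ^ Suc k * Polygamma (Suc k) (1 - z) - Polygamma (Suc k) z) (at z)"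
    by (auto intro!: derivative_eq_intros)
  have "(?r has_field_derivative (0 - two_pi_i ^ Suc k *
      (two_pi_i * polylog_neg (Suc k) (exp (two_pi_i * z))))) (at z)"
    by (intro DERIV_diff DERIV_const DERIV_cmult has_field_derivative_polylog_neg_exp Suc.prems)
  also have "?this \<longleftrightarrow> (?l has_field_derivative (0 - two_pi_i ^ Suc k *
      (two_pi_i * polylog_neg (Suc k) (exp (two_pi_i * z))))) (at z)"
  proof (rule DERIV_cong_ev [OF refl _ refl])
    show "\<forall>\<^sub>F z in nhds z. ?r z = ?l z"
      using eventually_nhds_in_open [of "{z. Im z > 0}" z] Suc
      by (auto elim!: eventually_mono simp: open_halfspace_Im_gt)
  qed
  finally have right: "(?l has_field_derivative (0 - two_pi_i ^ Suc k *
      (two_pi_i * polylog_neg (Suc k) (exp (two_pi_i * z))))) (at z)" .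
  from DERIV_unique [OF left right]
  show ?case by (simp only: power_Suc mult_ac) simp
qed

lemma Polygamma_two_sided_sums:
  assumes "Im z \<noteq> 0"
  shows "(\<lambda>j. 1 / (z + of_nat j) ^ Suc k + 1 / (z - of_nat (Suc j)) ^ Suc k) sums
    ((Polygamma k (1 - z) - (-1) ^ k * Polygamma k z) / fact k)"
proof -
  have nonzero: "z \<noteq> 0" "1 - z \<noteq> 0" using assms by (auto simp: complex_eq_iff)
  have neg: "1 / (z - of_nat (Suc j)) ^ Suc k =
      (-1) ^ Suc k * inverse ((1 - z + of_nat j) ^ Suc k)" for j
  proof -
    have "z - of_nat (Suc j) = - (1 - z + of_nat j)" by simp
    thus ?thesis
      by (simp only: power_minus [of "1 - z + of_nat j"])
        (simp add: minus_one_power_iff inverse_eq_divide del: power_Suc)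
  qed
  show ?thesis
  proof (cases "k = 0")
    case True
    have "(\<lambda>m. (of_real (ln (real m)) - (\<Sum>n<m. inverse (1 - z + of_nat n)))
        - (of_real (ln (real m)) - (\<Sum>n<m. inverse (z + of_nat n)))) \<longlonglongrightarrow> Digamma (1 - z) - Digamma z"
      by (intro tendsto_diff Digamma_LIMSEQ nonzero)
    thus ?thesis
      unfolding sums_def neg by (simp add: True inverse_eq_divide sum_subtractf)
  next
    case False
    have "(\<lambda>j. inverse ((z + of_nat j) ^ Suc k)
          + (-1) ^ Suc k * inverse ((1 - z + of_nat j) ^ Suc k)) sums
        ((-1) ^ Suc k * Polygamma k z / fact k
          + (-1) ^ Suc k * ((-1) ^ Suc k * Polygamma k (1 - z) / fact k))"
      using False nonzero by (intro sums_add sums_mult Polygamma_LIMSEQ) simp_all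
    thus ?thesis
      unfolding neg by (simp add: inverse_eq_divide diff_divide_distrib
          flip: mult.assoc power_mult_distrib)
  qed
qed

theorem Lipschitz_sums:
  assumes "Im z > 0"
  shows "(\<lambda>j. 1 / (z + of_nat j) ^ Suc k + 1 / (z - of_nat (Suc j)) ^ Suc k) sums
    ((if k = 0 then - of_real pi * \<i> else 0)
     + (- two_pi_i) ^ Suc k / fact k * polylog_neg k (exp (two_pi_i * z)))"
proof -
  define P where "P = polylog_neg k (exp (two_pi_i * z))"
  have "Polygamma k (1 - z) - (-1) ^ k * Polygamma k z =
      (-1) ^ k * ((-1) ^ k * Polygamma k (1 - z) - Polygamma k z)"
    by (simp add: right_diff_distrib flip: power_mult_distrib mult.assoc)
  also have "\<dots> = (-1) ^ k * ((if k = 0 then - of_real pi * \<i> else 0) - two_pi_i ^ Suc k * P)"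
    by (simp only: Polygamma_reflection [OF assms] P_def)
  also have "\<dots> = (if k = 0 then - of_real pi * \<i> else 0) + (- two_pi_i) ^ Suc k * P"
    using power_minus [of "two_pi_i" "Suc k"] by (simp add: right_diff_distrib)
  finally show ?thesis
    using Polygamma_two_sided_sums [of z k] assms
    by (cases "k = 0") (simp_all add: P_def add_divide_distrib del: power_Suc)
qed

corollary Lipschitz_symmetric_sums:
  assumes "Im z > 0"
  shows "(\<lambda>j. 1 / (z + of_nat (Suc j)) ^ Suc k + 1 / (z - of_nat (Suc j)) ^ Suc k) sums
    ((if k = 0 then - of_real pi * \<i> else 0) - 1 / z ^ Suc k
     + (- two_pi_i) ^ Suc k / fact k * polylog_neg k (exp (two_pi_i * z)))"
proof -
  have "(\<lambda>n. inverse (z + of_nat n)) \<longlonglongrightarrow> 0"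
    by (intro tendsto_inverse_0 [THEN filterlim_compose]
        tendsto_add_filterlim_at_infinity [OF tendsto_const] tendsto_of_nat)
  from tendsto_power [OF this, of "Suc k"]
  have "(\<lambda>n. 1 / (z + of_nat n) ^ Suc k) \<longlonglongrightarrow> 0" by (simp add: field_simps)
  from sums_add [OF Lipschitz_sums [OF assms, of k] telescope_sums [OF this]]
  show ?thesis by (simp add: algebra_simps del: of_nat_Suc power_Suc)
qed

section \<open>Lattice sums\<close>

definition pole_pair :: "nat \<Rightarrow> nat \<Rightarrow> real \<Rightarrow> complex" where
  "pole_pair k l u =
    1 / (of_nat l + \<i> * of_real u) ^ Suc k + 1 / (of_nat l - \<i> * of_real u) ^ Suc k"

lemma pole_pair_0: "even k \<Longrightarrow> pole_pair k 0 u = 0"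
  by (simp add: pole_pair_def)

lemma tendsto_pole_pair: "(\<lambda>l. pole_pair k l u) \<longlonglongrightarrow> 0"
proof -
  have "(\<lambda>l. 1 / (of_nat l + z) ^ Suc k) \<longlonglongrightarrow> 0" for z :: complex
  proof -
    have "(\<lambda>l. inverse (of_nat l + z)) \<longlonglongrightarrow> 0"
      by (intro tendsto_inverse_0 [THEN filterlim_compose]
          tendsto_add_filterlim_at_infinity' [OF _ tendsto_const] tendsto_of_nat)
    from tendsto_power [OF this, of "Suc k"] show ?thesis by (simp add: field_simps)
  qed
  from tendsto_add [OF this [of "\<i> * of_real u"] this [of "- \<i> * of_real u"]]
  show ?thesis by (simp add: pole_pair_def del: power_Suc)
qed

definition pole_pair_mean :: "nat \<Rightarrow> real \<Rightarrow> complex" where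
  "pole_pair_mean k v = (if k = 0 then of_real (pi / v) else 0)"

lemma pole_pair_column_sums:
  assumes "l > 0" "v > 0"
  shows "(\<lambda>m. pole_pair k l (real (Suc m) * v)) sums
    (pole_pair_mean k v + (of_real (2 * pi / v) ^ Suc k / fact k *
      polylog_neg k (of_real (exp (- (real l * (2 * pi / v))))) - 1 / of_nat l ^ Suc k))"
proof -
  define z where "z = \<i> * of_real (real l / v)"
  define c where "c = \<i> / of_real v"
  have z: "Im z > 0" using assms by (simp add: z_def)
  have c: "c ^ Suc k \<noteq> 0" using assms by (simp add: c_def)
  have "z + of_nat n = c * (of_nat l - \<i> * of_real (real n * v))"
    "z - of_nat n = c * (of_nat l + \<i> * of_real (real n * v))" for n
    using assms by (simp_all add: z_def c_def field_simps)
  hence pair: "c ^ Suc k * (1 / (z + of_nat n) ^ Suc k + 1 / (z - of_nat n) ^ Suc k) =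
      pole_pair k l (real n * v)" for n
    using c by (simp only: pole_pair_def power_mult_distrib) (simp add: distrib_left del: power_Suc)
  have pole: "c ^ Suc k * (1 / z ^ Suc k) = 1 / of_nat l ^ Suc k"
    using assms by (simp add: z_def c_def power_mult_distrib power_divide del: power_Suc)
  have factor: "c ^ Suc k * (- two_pi_i) ^ Suc k = of_real (2 * pi / v) ^ Suc k"
    by (simp only: power_mult_distrib [symmetric]) (simp add: c_def field_simps)
  have exp: "exp (two_pi_i * z) = of_real (exp (- (real l * (2 * pi / v))))"
    by (simp add: z_def exp_of_real [symmetric] mult_ac)
  have mean: "c ^ Suc k * (if k = 0 then - of_real pi * \<i> else 0) = pole_pair_mean k v"
    by (simp add: pole_pair_mean_def c_def mult.left_commute [of \<i>])
  have "c ^ Suc k * (A - Z + W / fact k * P) =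
      c ^ Suc k * A - c ^ Suc k * Z + c ^ Suc k * W / fact k * P"
    for A Z W P by (simp add: algebra_simps del: power_Suc)
  with sums_mult [OF Lipschitz_symmetric_sums [OF z, of k], of "c ^ Suc k"] show ?thesis
    by (simp only: pair exp mean pole factor)
      (simp add: algebra_simps del: power_Suc of_nat_Suc)
qed

definition pole_pair_remainder :: "nat \<Rightarrow> real \<Rightarrow> nat \<Rightarrow> complex" where
  "pole_pair_remainder k v l = (\<Sum>m. pole_pair k l (real (Suc m) * v)) - pole_pair_mean k v"

lemma pole_pair_remainder_0: "even k \<Longrightarrow> pole_pair_remainder k v 0 = - pole_pair_mean k v"
  by (simp add: pole_pair_remainder_def pole_pair_0)

lemma pole_pair_remainder_eq:
  assumes "l > 0" "v > 0"
  shows "pole_pair_remainder k v l = of_real (2 * pi / v) ^ Suc k / fact k *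
    polylog_neg k (of_real (exp (- (real l * (2 * pi / v))))) - 1 / of_nat l ^ Suc k"
  unfolding pole_pair_remainder_def sums_unique [OF pole_pair_column_sums [OF assms], symmetric]
  by (rule add_diff_cancel_left')

lemma pole_pair_remainder_sums:
  assumes "even k" "v > 0"
  shows "(\<lambda>m. pole_pair k l (real (Suc m) * v)) sums
      (pole_pair_mean k v + pole_pair_remainder k v l)"
proof (cases "l = 0")
  case True
  thus ?thesis using assms(1) by (simp add: pole_pair_0 pole_pair_remainder_0)
next
  case False
  thus ?thesis using assms(2) pole_pair_column_sums [of l v k]
    by (simp only: pole_pair_remainder_eq neq0_conv)
qed

lemma tendsto_pole_pair_remainder:
  assumes "v > 0" shows "pole_pair_remainder k v \<longlonglongrightarrow> 0"
proof -
  have "filterlim (\<lambda>l. real l * (2 * pi / v)) at_top sequentially"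
    using assms by (intro filterlim_at_top_mult_tendsto_pos [OF tendsto_const]
        filterlim_real_sequentially) simp_all
  hence "(\<lambda>l. exp (- (real l * (2 * pi / v)))) \<longlonglongrightarrow> 0"
    by (intro filterlim_compose [OF exp_at_bot] filterlim_uminus_at_bot [THEN iffD2]) simp
  from tendsto_of_real [OF this, where 'a = complex]
  have "filterlim (\<lambda>l. complex_of_real (exp (- (real l * (2 * pi / v))))) (at 0) sequentially"
    by (intro filterlim_atI) simp_all
  from filterlim_compose [OF tendsto_polylog_neg_0 [of k] this]
  have "(\<lambda>l. of_real (2 * pi / v) ^ Suc k / fact k *
      polylog_neg k (of_real (exp (- (real l * (2 * pi / v))))) - inverse (of_nat l) ^ Suc k)
      \<longlonglongrightarrow> of_real (2 * pi / v) ^ Suc k / fact k * 0 - 0 ^ Suc k"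
    by (intro tendsto_intros lim_inverse_n)
  hence "(\<lambda>l. of_real (2 * pi / v) ^ Suc k / fact k *
      polylog_neg k (of_real (exp (- (real l * (2 * pi / v))))) - 1 / of_nat l ^ Suc k) \<longlonglongrightarrow> 0"
    by (simp add: power_inverse inverse_eq_divide power_one_over del: power_Suc)
  moreover have "\<forall>\<^sub>F l in sequentially. of_real (2 * pi / v) ^ Suc k / fact k *
      polylog_neg k (of_real (exp (- (real l * (2 * pi / v))))) - 1 / of_nat l ^ Suc k =
      pole_pair_remainder k v l"
    using eventually_gt_at_top [of 0] by eventually_elim (simp only: pole_pair_remainder_eq assms)
  ultimately show ?thesis by (rule Lim_transform_eventually)
qed

subsection \<open>Absolute convergence of the second differences\<close>

definition lattice_weight :: "nat \<Rightarrow> real" where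
  "lattice_weight n = real (Suc n) powr (- 3 / 2)"

lemma inverse_norm_lattice_le:
  fixes w :: complex
  assumes "v > 0" "Re w \<ge> real l" "\<bar>Im w\<bar> = real (Suc m) * v"
  shows "inverse (norm w) \<le> sqrt (1 + 2 / v\<^sup>2) * inverse (sqrt (real (Suc l) * real (Suc m)))"
proof -
  define b where "b = real (Suc m)"
  have b: "b \<ge> 1" by (simp add: b_def)
  have "2 * ((real l + 1) * b) \<le> (real l + 1)\<^sup>2 + b\<^sup>2"
    using sum_squares_bound [of "real l + 1" b] by (simp only: mult.assoc)
  moreover have "(real l + 1)\<^sup>2 \<le> 2 * (real l)\<^sup>2 + 2"
    using sum_squares_bound [of "real l" 1] by (simp add: power2_sum)
  moreover have "1 \<le> b\<^sup>2" using b by simp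
  ultimately have "(real l + 1) * b \<le> (real l)\<^sup>2 + 2 * b\<^sup>2"
    using zero_le_power2 [of "real l"] by linarith
  also have "\<dots> \<le> (Re w)\<^sup>2 + 2 / v\<^sup>2 * (Im w)\<^sup>2"
  proof -
    have "(Im w)\<^sup>2 = b\<^sup>2 * v\<^sup>2"
      using assms(3) by (metis b_def power2_abs power_mult_distrib)
    moreover have "(real l)\<^sup>2 \<le> (Re w)\<^sup>2" using assms(2) by (intro power_mono) simp_all
    ultimately show ?thesis using assms(1) by simp
  qed
  also have "\<dots> \<le> (1 + 2 / v\<^sup>2) * ((Re w)\<^sup>2 + (Im w)\<^sup>2)"
    by (simp add: algebra_simps)
  finally have "real (Suc l) * real (Suc m) \<le> (1 + 2 / v\<^sup>2) * (norm w)\<^sup>2"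
    by (simp add: b_def cmod_power2 add.commute)
  from real_sqrt_le_mono [OF this]
  have "sqrt (real (Suc l) * real (Suc m)) \<le> sqrt (1 + 2 / v\<^sup>2) * norm w"
    by (simp add: real_sqrt_mult)
  moreover have "norm w > 0" using assms by (auto simp: complex_eq_iff)
  moreover have "sqrt (real (Suc l) * real (Suc m)) > 0" by simp
  ultimately show ?thesis by (simp add: field_simps del: of_nat_Suc)
qed

lemma inverse_norm_power_lattice_le:
  fixes w :: complex
  assumes "v > 0" "Re w \<ge> real l" "\<bar>Im w\<bar> = real (Suc m) * v" "N \<ge> 3"
  shows "inverse (norm w) ^ N \<le> sqrt (1 + 2 / v\<^sup>2) ^ N * (lattice_weight l * lattice_weight m)"
proof -
  define r where "r = inverse (sqrt (real (Suc l) * real (Suc m)))"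
  have "1 \<le> real (Suc l) * real (Suc m)"
    using mult_mono [of 1 "real (Suc l)" 1 "real (Suc m)"] by simp
  hence r: "0 \<le> r" "r \<le> 1" by (simp_all add: r_def inverse_le_1_iff)
  have "inverse (norm w) ^ N \<le> (sqrt (1 + 2 / v\<^sup>2) * r) ^ N"
    using inverse_norm_lattice_le [OF assms(1-3)] unfolding r_def by (intro power_mono) simp_all
  also have "\<dots> \<le> sqrt (1 + 2 / v\<^sup>2) ^ N * r ^ 3"
    unfolding power_mult_distrib using assms(4) r
    by (intro mult_left_mono power_decreasing) simp_all
  also have "r ^ 3 = lattice_weight l * lattice_weight m"
  proof -
    have "r = (real (Suc l) * real (Suc m)) powr (- 1 / 2)"
      by (simp add: r_def powr_half_sqrt [symmetric] powr_minus)
    hence "r ^ 3 = (real (Suc l) * real (Suc m)) powr (- 3 / 2)" by (simp add: powr_power)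
    thus ?thesis by (simp add: lattice_weight_def powr_mult)
  qed
  finally show ?thesis .
qed

lemma norm_second_difference_inverse_power_le:
  fixes z :: complex
  assumes "k \<noteq> 1" "Re z \<ge> 0" "z \<noteq> 0"
  shows "norm (1 / z ^ Suc k - 2 * (1 / (z + 1) ^ Suc k) + 1 / (z + 2) ^ Suc k) \<le>
    4 * inverse (norm z) ^ max 3 (Suc k)"
proof -
  define t where "t w = inverse (norm w)" for w :: complex
  have norm_le: "norm z \<le> norm (z + of_real a)" if "a \<ge> 0" for a
    unfolding cmod_def using assms(2) that by (auto intro!: power_mono)
  have "t (z + of_real a) \<le> t z" "z + of_real a \<noteq> 0" if "a \<ge> 0" for a
    using norm_le [OF that] assms(3) by (auto simp: t_def intro!: le_imp_inverse_le)
  from this [of 1] this [of 2] have t: "t (z + 1) \<le> t z" "t (z + 2) \<le> t z"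
    and nonzero: "z + 1 \<noteq> 0" "z + 2 \<noteq> 0" by simp_all
  have t_nonneg: "t w \<ge> 0" for w by (simp add: t_def)
  have "norm (1 / z ^ Suc k - 2 * (1 / (z + 1) ^ Suc k) + 1 / (z + 2) ^ Suc k) \<le>
      4 * t z ^ max 3 (Suc k)"
  proof (cases "k = 0")
    case True
    have "1 / z - 2 * (1 / (z + 1)) + 1 / (z + 2) = 2 / (z * (z + 1) * (z + 2))"
      using assms(3) nonzero by (simp add: divide_simps) (simp add: algebra_simps)
    hence "norm (1 / z - 2 * (1 / (z + 1)) + 1 / (z + 2)) = 2 * (t z * t (z + 1) * t (z + 2))"
      by (simp add: t_def norm_divide norm_mult norm_inverse divide_inverse)
    also have "\<dots> \<le> 4 * (t z * t z * t z)"
      using t by (intro mult_mono mult_nonneg_nonneg order.refl t_nonneg) simp_all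
    finally show ?thesis using True by (simp add: power3_eq_cube)
  next
    case False
    have inverse_power: "norm (1 / w ^ Suc k) = t w ^ Suc k" for w
      by (simp add: t_def norm_power norm_inverse divide_inverse power_inverse del: power_Suc)
    have "norm (A - 2 * B + C) \<le> norm A + 2 * norm B + norm C" for A B C :: complex
      using norm_triangle_ineq [of "A - 2 * B" C] norm_triangle_ineq4 [of A "2 * B"]
      by (simp add: norm_mult)
    hence "norm (1 / z ^ Suc k - 2 * (1 / (z + 1) ^ Suc k) + 1 / (z + 2) ^ Suc k) \<le>
        t z ^ Suc k + 2 * t (z + 1) ^ Suc k + t (z + 2) ^ Suc k"
      by (simp only: flip: inverse_power)
    also have "\<dots> \<le> t z ^ Suc k + 2 * t z ^ Suc k + t z ^ Suc k"
      using t by (intro add_mono mult_left_mono power_mono t_nonneg) simp_all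
    finally show ?thesis using False assms(1) by (simp add: max_def del: power_Suc)
  qed
  thus ?thesis by (simp only: t_def)
qed

lemma norm_second_difference_pole_pair_le:
  assumes "k \<noteq> 1" "v > 0"
  shows "norm (second_difference (\<lambda>l. pole_pair k l (real (Suc m) * v)) l) \<le>
    8 * sqrt (1 + 2 / v\<^sup>2) ^ max 3 (Suc k) * (lattice_weight l * lattice_weight m)"
proof -
  define \<Delta> where "\<Delta> z = 1 / z ^ Suc k - 2 * (1 / (z + 1) ^ Suc k) + 1 / (z + 2) ^ Suc k"
      for z :: complex
  define u where "u = real (Suc m) * v"
  let ?bound = "4 * (sqrt (1 + 2 / v\<^sup>2) ^ max 3 (Suc k) * (lattice_weight l * lattice_weight m))"
  have \<Delta>: "norm (\<Delta> z) \<le> ?bound" if "Re z = real l" "\<bar>Im z\<bar> = u" for z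
  proof -
    have "Re z \<ge> 0" "z \<noteq> 0" using that assms(2) by (auto simp: u_def)
    hence "norm (\<Delta> z) \<le> 4 * inverse (norm z) ^ max 3 (Suc k)"
      unfolding \<Delta>_def by (intro norm_second_difference_inverse_power_le assms(1))
    also have "\<dots> \<le> ?bound"
      using that assms(2) unfolding u_def
      by (intro mult_left_mono inverse_norm_power_lattice_le) simp_all
    finally show ?thesis .
  qed
  have "second_difference (\<lambda>l. pole_pair k l u) l =
      \<Delta> (of_nat l + \<i> * of_real u) + \<Delta> (of_nat l - \<i> * of_real u)"
    by (simp add: \<Delta>_def second_difference_def pole_pair_def algebra_simps del: power_Suc)
  also have "norm \<dots> \<le> ?bound + ?bound"
    using assms(2) by (intro norm_triangle_le add_mono \<Delta>) (simp_all add: u_def)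
  finally show ?thesis by (simp add: u_def mult_ac)
qed

lemma summable_on_second_difference_pole_pair:
  assumes "k \<noteq> 1" "v > 0" "Bseq B"
  shows "(\<lambda>(l, m). B (l + 2) * second_difference (\<lambda>l. pole_pair k l (real (Suc m) * v)) l)
      summable_on UNIV"
proof -
  obtain M where M: "M > 0" "\<And>n. norm (B n) \<le> M" using assms(3) unfolding Bseq_def by blast
  define C where "C = 8 * sqrt (1 + 2 / v\<^sup>2) ^ max 3 (Suc k)"
  have weight: "summable lattice_weight" "lattice_weight n \<ge> 0" for n
    unfolding lattice_weight_def by (rule summable_Suc_powr) simp_all
  show ?thesis
  proof (rule summable_on_prodI)
    show "summable (\<lambda>l. M * C * lattice_weight l)" using weight(1) by (rule summable_mult)
    show "M * C * lattice_weight l \<ge> 0" for l using M(1) weight(2) by (simp add: C_def)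
    show "norm (B (l + 2) * second_difference (\<lambda>l. pole_pair k l (real (Suc m) * v)) l) \<le>
        M * C * lattice_weight l * lattice_weight m" for l m
    proof -
      have "norm (B (l + 2)) * norm (second_difference (\<lambda>l. pole_pair k l (real (Suc m) * v)) l) \<le>
          M * (C * (lattice_weight l * lattice_weight m))"
        unfolding C_def using M assms(1,2)
        by (intro mult_mono norm_second_difference_pole_pair_le) simp_all
      thus ?thesis by (simp add: norm_mult mult_ac)
    qed
  qed (rule weight)+
qed

subsection \<open>Interchanging the order of summation\<close>

lemma pole_pair_sums_interchange:
  assumes "Bseq B" "B 1 = 0" "even k" "v > 0"
  obtains T where "\<And>m. summable (\<lambda>l. second_difference B l * pole_pair k l (real (Suc m) * v))"
    "(\<lambda>m. \<Sum>l. second_difference B l * pole_pair k l (real (Suc m) * v)) sums T"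
    "(\<lambda>l. second_difference B l * pole_pair_remainder k v l) sums (T - B 0 * pole_pair_mean k v)"
proof -
  define p where "p m l = pole_pair k l (real (Suc m) * v)" for m l
  define r where "r = pole_pair_remainder k v"
  define g where "g l m = B (l + 2) * second_difference (p m) l" for l m
  have "k \<noteq> 1" using assms(3) by auto
  from summable_on_second_difference_pole_pair [OF this assms(4,1)]
  obtain T where T: "((\<lambda>(l, m). g l m) has_sum T) UNIV"
    unfolding g_def p_def summable_on_def by blast
  have row: "(\<lambda>l. second_difference B l * p m l) sums (\<Sum>l. g l m)" for m
  proof -
    have "(\<lambda>l. g l m) sums (\<Sum>l. g l m)"
      using has_sum_columns_imp_sums(1) [OF T] by (rule summable_sums)
    moreover have "p m \<longlonglongrightarrow> 0" unfolding p_def by (rule tendsto_pole_pair)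
    ultimately have "(\<lambda>l. second_difference B l * p m l) sums ((\<Sum>l. g l m) + B 0 * p m 0)"
      unfolding g_def by (intro sums_Abel_twice assms(1,2))
    thus ?thesis using assms(3) by (simp add: p_def pole_pair_0)
  qed
  have "(\<Sum>m. g l m) = B (l + 2) * second_difference r l" for l
  proof -
    have "(\<lambda>m. p m l) sums (pole_pair_mean k v + r l)" for l
      unfolding p_def r_def by (rule pole_pair_remainder_sums [OF assms(3,4)])
    hence "g l sums (B (l + 2) * ((pole_pair_mean k v + r l) - 2 * (pole_pair_mean k v + r (l + 1))
        + (pole_pair_mean k v + r (l + 2))))"
      unfolding g_def second_difference_def by (intro sums_mult sums_add sums_diff)
    thus ?thesis by (simp add: sums_iff second_difference_def algebra_simps)
  qed
  with has_sum_rows_imp_sums(2) [OF T]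
  have "(\<lambda>l. B (l + 2) * second_difference r l) sums T" by simp
  moreover have "r \<longlonglongrightarrow> 0" unfolding r_def by (rule tendsto_pole_pair_remainder [OF assms(4)])
  ultimately have column: "(\<lambda>l. second_difference B l * r l) sums (T + B 0 * r 0)"
    by (intro sums_Abel_twice assms(1,2))
  have rows: "(\<lambda>m. \<Sum>l. second_difference B l * p m l) sums T"
    using has_sum_columns_imp_sums(2) [OF T] sums_unique [OF row] by simp
  from that [of T] sums_summable [OF row] rows column show ?thesis
    by (simp add: p_def r_def pole_pair_remainder_0 assms(3))
qed

lemma dft_polylog_neg_sums:
  assumes "y > 0"
  shows "(\<lambda>d. of_nat (Suc d) ^ k * dft q f (Suc d) * of_real (exp (- (real (Suc d) * y)))) sums
    (\<Sum>h<q. f h * polylog_neg k (unity_exp q h * of_real (exp (- y))))"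
proof -
  define w where "w h = unity_exp q h * of_real (exp (- y))" for h
  have "norm (w h) < 1" for h using assms by (simp add: w_def unity_exp_def norm_mult)
  hence "(\<lambda>d. \<Sum>h<q. f h * (of_nat (Suc d) ^ k * w h ^ Suc d)) sums
      (\<Sum>h<q. f h * polylog_neg k (w h))"
    by (intro sums_sum sums_mult polylog_neg_sums)
  moreover have "(\<Sum>h<q. f h * (of_nat (Suc d) ^ k * w h ^ Suc d)) =
      of_nat (Suc d) ^ k * dft q f (Suc d) * of_real (exp (- (real (Suc d) * y)))" for d
  proof -
    have "w h ^ Suc d = unity_exp q (h * Suc d) * of_real (exp (- (real (Suc d) * y)))" for h
      using exp_of_nat_mult [of "Suc d" "- y"]
      by (simp add: w_def power_mult_distrib unity_exp_mult del: power_Suc of_nat_Suc mult_Suc_right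
          flip: of_real_power)
    thus ?thesis
      by (simp only: dft_def sum_distrib_left sum_distrib_right mult_ac)
  qed
  ultimately show ?thesis by (simp only: w_def)
qed

context odd_periodic_seq
begin

lemma sum_pole_pair_block:
  fixes u :: real
  assumes "even k"
  defines "z \<equiv> \<lambda>h. (of_nat h + \<i> * of_real u) / of_nat q"
  shows "(\<Sum>h<q. f h * (1 / (z h + of_nat j) ^ Suc k + 1 / (z h - of_nat (Suc j)) ^ Suc k)) =
    of_nat q ^ Suc k * (\<Sum>h<q. f (j * q + h) * pole_pair k (j * q + h) u)"
proof -
  define P where "P h = 1 / (of_nat (j * q + h) + \<i> * of_real u) ^ Suc k" for h
  define N where "N h = 1 / (of_nat (j * q + h) - \<i> * of_real u) ^ Suc k" for h
  have "z h + of_nat j = (of_nat (j * q + h) + \<i> * of_real u) / of_nat q" for h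
    using modulus_pos by (simp add: z_def field_simps)
  hence P: "1 / (z h + of_nat j) ^ Suc k = of_nat q ^ Suc k * P h" for h
    by (simp add: P_def power_divide del: power_Suc)
  have N: "1 / (z h - of_nat (Suc j)) ^ Suc k = - (of_nat q ^ Suc k * N (q - h))" if "h < q" for h
  proof -
    have "z h - of_nat (Suc j) = - ((of_nat (j * q + (q - h)) - \<i> * of_real u) / of_nat q)"
      using that by (simp add: z_def field_simps of_nat_diff)
    thus ?thesis using assms(1) by (simp add: N_def power_divide del: power_Suc)
  qed
  have "(\<Sum>h<q. f h * (1 / (z h + of_nat j) ^ Suc k + 1 / (z h - of_nat (Suc j)) ^ Suc k)) =
      of_nat q ^ Suc k * ((\<Sum>h<q. f h * P h) - (\<Sum>h<q. f h * N (q - h)))"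
    by (simp add: P N right_diff_distrib distrib_left sum_subtractf sum_distrib_left mult_ac
        del: power_Suc of_nat_Suc)
  also have "\<dots> = of_nat q ^ Suc k * (\<Sum>h<q. f h * (P h + N h))"
    by (simp only: sum_mult_reflect [of N]) (simp add: sum.distrib distrib_left)
  also have "\<dots> = of_nat q ^ Suc k * (\<Sum>h<q. f (j * q + h) * pole_pair k (j * q + h) u)"
    using periodic_add_mult [of _ j] by (simp add: P_def N_def pole_pair_def add.commute)
  finally show ?thesis .
qed

lemma pole_pair_row_sum:
  assumes "even k" "u > 0" "summable (\<lambda>l. f l * pole_pair k l u)"
  shows "(\<Sum>l. f l * pole_pair k l u) = (- two_pi_i / of_nat q) ^ Suc k / fact k *
    (\<Sum>d. of_nat (Suc d) ^ k * dft q f (Suc d)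
      * of_real (exp (- (real (Suc d) * (2 * pi * u / real q)))))"
proof -
  define z where "z h = (of_nat h + \<i> * of_real u) / of_nat q" for h
  define W :: complex where "W = (- two_pi_i) ^ Suc k / fact k"
  define C :: complex where "C = (if k = 0 then - of_real pi * \<i> else 0)"
  define P where "P h = polylog_neg k (unity_exp q h * of_real (exp (- (2 * pi * u / real q))))"
      for h
  have exp: "exp (two_pi_i * z h) = unity_exp q h * of_real (exp (- (2 * pi * u / real q)))" for h
    by (simp add: z_def unity_exp_def exp_of_real [symmetric] exp_add [symmetric] distrib_left
        add_divide_distrib mult_ac)
  have "Im (z h) > 0" for h using assms(2) modulus_pos by (simp add: z_def)
  from Lipschitz_sums [OF this, where k = k]
  have "(\<lambda>j. \<Sum>h<q. f h * (1 / (z h + of_nat j) ^ Suc k + 1 / (z h - of_nat (Suc j)) ^ Suc k)) sums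
      (\<Sum>h<q. f h * (C + W * P h))"
    unfolding exp C_def W_def P_def by (intro sums_sum sums_mult)
  hence "(\<lambda>j. of_nat q ^ Suc k * (\<Sum>h<q. f (j * q + h) * pole_pair k (j * q + h) u)) sums
      (\<Sum>h<q. f h * (C + W * P h))"
    by (simp only: sum_pole_pair_block [OF assms(1)] z_def)
  moreover have "(\<lambda>j. \<Sum>h<q. f (j * q + h) * pole_pair k (j * q + h) u) sums
      (\<Sum>l. f l * pole_pair k l u)"
    using sums_group [OF summable_sums [OF assms(3)] modulus_pos]
    by (simp add: sum.shift_bounds_nat_ivl [of _ 0, simplified] lessThan_atLeast0 add_ac)
  ultimately have "of_nat q ^ Suc k * (\<Sum>l. f l * pole_pair k l u) = (\<Sum>h<q. f h * (C + W * P h))"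
    using sums_mult sums_unique2 by blast
  also have "\<dots> = (\<Sum>h<q. f h) * C + W * (\<Sum>h<q. f h * P h)"
    by (simp add: distrib_left sum.distrib sum_distrib_left sum_distrib_right mult_ac)
  also have "(\<Sum>h<q. f h * P h) = (\<Sum>d. of_nat (Suc d) ^ k * dft q f (Suc d) *
      of_real (exp (- (real (Suc d) * (2 * pi * u / real q)))))"
    using dft_polylog_neg_sums [of "2 * pi * u / real q" k q f] assms(2) modulus_pos
    unfolding P_def by (intro sums_unique) simp
  finally have "(\<Sum>l. f l * pole_pair k l u) = W / of_nat q ^ Suc k *
      (\<Sum>d. of_nat (Suc d) ^ k * dft q f (Suc d)
        * of_real (exp (- (real (Suc d) * (2 * pi * u / real q)))))"
    using modulus_pos by (simp add: sum_period_eq_0 eq_divide_eq mult.commute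
        del: power_Suc of_nat_Suc)
  also have "W / of_nat q ^ Suc k = (- two_pi_i / of_nat q) ^ Suc k / fact k"
    unfolding W_def power_divide by simp
  finally show ?thesis .
qed

end

section \<open>Transformation of the Eisenstein series\<close>

lemma lambert_series_polylog_neg_sums:
  assumes "Bseq b" "y > 0"
  shows "(\<lambda>j. b (Suc j) * polylog_neg k (of_real (exp (- (real (Suc j) * y))))) sums
    lambert_series k (\<lambda>_. 1) b y"
proof -
  have "complex_of_real (exp (- (real (Suc j) * y))) ^ Suc i =
      of_real (exp (- (real (Suc i) * (real (Suc j) * y))))" for i j
    using exp_of_nat_mult [of "Suc i" "- (real (Suc j) * y)"]
    by (simp del: power_Suc of_nat_Suc flip: of_real_power)
  thus ?thesis
    using lambert_series_column_sums [of "\<lambda>_. 1" b y k] assms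
    by (simp only: polylog_neg_def mult_1_right) simp
qed

lemma dirichlet_L_eqI:
  assumes "(\<lambda>n. f n / of_nat n ^ N) sums S" and "N > 0"
  shows "dirichlet_L f (of_nat N) = S"
proof -
  have "(\<lambda>M. \<Sum>n<Suc M. f n / of_nat n ^ N) \<longlonglongrightarrow> S"
    using assms(1) unfolding sums_def by (rule LIMSEQ_Suc)
  also have "(\<lambda>M. \<Sum>n<Suc M. f n / of_nat n ^ N) = (\<lambda>M. \<Sum>n=1..M. f n / of_nat n powr of_nat N)"
  proof
    fix M
    have "(\<Sum>n<Suc M. f n / of_nat n ^ N) = (\<Sum>n=1..M. f n / of_nat n ^ N)"
      using assms(2) by (simp add: lessThan_Suc_atMost atMost_atLeast0 sum.atLeast_Suc_atMost)
    also have "\<dots> = (\<Sum>n=1..M. f n / of_nat n powr of_nat N)"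
      by (intro sum.cong refl) (auto simp: powr_nat')
    finally show "(\<Sum>n<Suc M. f n / of_nat n ^ N) = (\<Sum>n=1..M. f n / of_nat n powr of_nat N)" .
  qed
  finally show ?thesis unfolding dirichlet_L_def by (rule limI)
qed

definition fricke :: "nat \<Rightarrow> real \<Rightarrow> real" where
  "fricke q y = 4 * pi\<^sup>2 / (real q * y)"

lemma fricke_pos: "q > 0 \<Longrightarrow> y > 0 \<Longrightarrow> fricke q y > 0"
  by (simp add: fricke_def)

lemma fricke_fricke: "q > 0 \<Longrightarrow> y > 0 \<Longrightarrow> fricke q (fricke q y) = y"
  by (simp add: fricke_def)

lemma two_pi_i_mult_fricke:
  assumes "q > 0"
  shows "of_nat q / two_pi_i * of_real (fricke q y) = - (two_pi_i / of_real y)"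
proof -
  have "of_nat q / two_pi_i * of_real (fricke q y) = of_real (4 * pi\<^sup>2) / (two_pi_i * of_real y)"
    using assms by (simp add: fricke_def)
  also have "complex_of_real (4 * pi\<^sup>2) = - (two_pi_i * two_pi_i)"
    by (simp add: power2_eq_square algebra_simps)
  finally show ?thesis by simp
qed

context odd_periodic_seq
begin

lemma Bseq_dft: "Bseq (dft q f)"
  by (rule periodic_seq.Bseq_periodic [OF periodic_seq_dft [OF modulus_pos]])

lemma pole_pair_lattice_sum:
  assumes "even k" "y > 0" and v: "v = real q * y / (2 * pi)"
    and summable: "\<And>m. summable (\<lambda>l. f l * pole_pair k l (real (Suc m) * v))"
    and T: "(\<lambda>m. \<Sum>l. f l * pole_pair k l (real (Suc m) * v)) sums T"
  shows "T = (- two_pi_i / of_nat q) ^ Suc k / fact k * lambert_series k (dft q f) (\<lambda>_. 1) y"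
proof -
  define W where "W = (- two_pi_i / of_nat q) ^ Suc k / fact k"
  have "(\<Sum>l. f l * pole_pair k l (real (Suc m) * v)) =
      W * (\<Sum>d. of_nat (Suc d) ^ k * dft q f (Suc d) *
      of_real (exp (- (real (Suc d) * (real (Suc m) * y)))))" for m
  proof -
    have y_eq: "2 * pi * (real (Suc m) * v) / real q = real (Suc m) * y"
      using modulus_pos by (simp add: v del: of_nat_Suc)
    have "real (Suc m) * v > 0" using assms(2) modulus_pos by (simp add: v)
    from pole_pair_row_sum [OF assms(1) this summable] show ?thesis
      unfolding y_eq W_def .
  qed
  with T have "(\<lambda>m. W * (\<Sum>d. of_nat (Suc d) ^ k * dft q f (Suc d) *
      of_real (exp (- (real (Suc d) * (real (Suc m) * y)))))) sums T" by (simp only:)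
  moreover have "(\<lambda>m. W * (\<Sum>d. of_nat (Suc d) ^ k * dft q f (Suc d) *
      of_real (exp (- (real (Suc d) * (real (Suc m) * y)))))) sums
      (W * lambert_series k (dft q f) (\<lambda>_. 1) y)"
    using lambert_series_column_sums [OF Bseq_dft _ assms(2), of "\<lambda>_. 1" k]
    by (intro sums_mult) simp
  ultimately show ?thesis unfolding W_def by (rule sums_unique2)
qed

lemma dirichlet_series_sums_lambert_series:
  assumes "even k"
  shows "\<exists>C. \<forall>y>0. (\<lambda>l. f l / of_nat l ^ Suc k) sums
    ((if k = 0 then C / of_real y else 0)
     + of_real (fricke q y) ^ Suc k / fact k * lambert_series k (\<lambda>_. 1) f (fricke q y)
     - (- two_pi_i / of_nat q) ^ Suc k / fact k * lambert_series k (dft q f) (\<lambda>_. 1) y)"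
proof -
  obtain B where B: "Bseq B" "B 1 = 0" and f_eq: "f = second_difference B"
    using periodic_eq_second_difference [OF sum_period_eq_0] by blast
  show ?thesis
  proof (intro exI allI impI)
    fix y :: real assume y: "y > 0"
    define v where "v = real q * y / (2 * pi)"
    have v: "v > 0" using y modulus_pos by (simp add: v_def)
    have y': "fricke q y > 0" "2 * pi / v = fricke q y"
      using y modulus_pos by (simp_all add: v_def fricke_def power2_eq_square)
    have mean: "B 0 * pole_pair_mean k v =
        (if k = 0 then B 0 * of_real (2 * pi\<^sup>2 / real q) / of_real y else 0)"
      by (simp add: pole_pair_mean_def v_def power2_eq_square)
    obtain T where summable: "\<And>m. summable (\<lambda>l. f l * pole_pair k l (real (Suc m) * v))"
      and rows: "(\<lambda>m. \<Sum>l. f l * pole_pair k l (real (Suc m) * v)) sums T"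
      and columns: "(\<lambda>l. f l * pole_pair_remainder k v l) sums (T - B 0 * pole_pair_mean k v)"
      using pole_pair_sums_interchange [OF B assms v] unfolding f_eq by blast
    have remainder: "of_real (fricke q y) ^ Suc k / fact k
        * (f l * polylog_neg k (of_real (exp (- (real l * fricke q y)))))
        - f l * pole_pair_remainder k v l = f l / of_nat l ^ Suc k" for l
      by (cases "l = 0")
        (simp_all add: pole_pair_remainder_eq [OF _ v, unfolded y'(2)] right_diff_distrib
          mult.left_commute del: power_Suc)
    have "(\<lambda>l. f l * polylog_neg k (of_real (exp (- (real l * fricke q y))))) sums
        lambert_series k (\<lambda>_. 1) f (fricke q y)"
      using sums_Suc [OF lambert_series_polylog_neg_sums [OF Bseq_periodic y'(1), of k]] by simp
    from sums_diff [OF sums_mult [OF this, of "of_real (fricke q y) ^ Suc k / fact k"] columns]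
    show "(\<lambda>l. f l / of_nat l ^ Suc k) sums
      ((if k = 0 then B 0 * of_real (2 * pi\<^sup>2 / real q) / of_real y else 0)
       + of_real (fricke q y) ^ Suc k / fact k * lambert_series k (\<lambda>_. 1) f (fricke q y)
       - (- two_pi_i / of_nat q) ^ Suc k / fact k * lambert_series k (dft q f) (\<lambda>_. 1) y)"
      unfolding remainder mean pole_pair_lattice_sum [OF assms y v_def summable rows]
      by (simp add: algebra_simps del: power_Suc)
  qed
qed

lemma dirichlet_L_sums:
  assumes "even k"
  shows "(\<lambda>n. f n / of_nat n ^ Suc k) sums dirichlet_L f (of_nat (Suc k))"
proof -
  have "summable (\<lambda>n. f n / of_nat n ^ Suc k)"
    using dirichlet_series_sums_lambert_series [OF assms] zero_less_one [where 'a = real]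
    unfolding summable_def by blast
  from dirichlet_L_eqI [OF summable_sums [OF this]] summable_sums [OF this] show ?thesis by simp
qed

lemma lambert_series_dft_transform:
  assumes "even k"
  shows "\<exists>C. \<forall>y>0. lambert_series k (dft q f) (\<lambda>_. 1) y =
    (if k = 0 then C / of_real y else 0)
    + fact k * (of_nat q / two_pi_i) ^ Suc k * dirichlet_L f (of_nat (Suc k))
    + (two_pi_i / of_real y) ^ Suc k * lambert_series k (\<lambda>_. 1) f (fricke q y)"
proof -
  define L where "L = dirichlet_L f (of_nat (Suc k))"
  define r where "r = (of_nat q / two_pi_i) ^ Suc k"
  obtain C where C: "\<forall>y>0. (\<lambda>l. f l / of_nat l ^ Suc k) sums
    ((if k = 0 then C / of_real y else 0)
     + of_real (fricke q y) ^ Suc k / fact k * lambert_series k (\<lambda>_. 1) f (fricke q y)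
     - (- two_pi_i / of_nat q) ^ Suc k / fact k * lambert_series k (dft q f) (\<lambda>_. 1) y)"
    using dirichlet_series_sums_lambert_series [OF assms] by blast
  show ?thesis
  proof (intro exI allI impI)
    fix y :: real assume y: "y > 0"
    define \<Lambda> where "\<Lambda> = lambert_series k (dft q f) (\<lambda>_. 1) y"
    define \<Lambda>' where "\<Lambda>' = lambert_series k (\<lambda>_. 1) f (fricke q y)"
    define M where "M = (if k = 0 then C / of_real y else 0)"
    define X where "X = (- two_pi_i / of_nat q) ^ Suc k"
    define Y where "Y = complex_of_real (fricke q y) ^ Suc k"
    have "r * X = (-1) ^ Suc k"
      unfolding r_def X_def power_mult_distrib [symmetric] using modulus_pos by simp
    hence X: "r * X = - 1" using assms by simp
    have "r * Y = (- (two_pi_i / of_real y)) ^ Suc k"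
      by (simp only: r_def Y_def power_mult_distrib [symmetric]
          two_pi_i_mult_fricke [OF modulus_pos])
    hence Y: "r * Y = - ((two_pi_i / of_real y) ^ Suc k)"
      using assms by (simp only: power_minus_odd even_Suc not_not)
    have L_eq: "L = M + Y / fact k * \<Lambda>' - X / fact k * \<Lambda>"
      unfolding L_def \<Lambda>_def \<Lambda>'_def M_def X_def Y_def using C y by (intro dirichlet_L_eqI) auto
    have "fact k * r * L = fact k * r * M + r * Y * \<Lambda>' - r * X * \<Lambda>"
      unfolding L_eq by (simp add: algebra_simps)
    hence "\<Lambda> = - (fact k * r * M) + fact k * r * L + (two_pi_i / of_real y) ^ Suc k * \<Lambda>'"
      unfolding X Y by (simp add: algebra_simps del: power_Suc)
    also have "- (fact k * r * M) = (if k = 0 then - (of_nat q / two_pi_i * C) / of_real y else 0)"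
      by (simp add: M_def r_def)
    finally show "\<Lambda> = (if k = 0 then - (of_nat q / two_pi_i * C) / of_real y else 0)
        + fact k * (of_nat q / two_pi_i) ^ Suc k * dirichlet_L f (of_nat (Suc k))
        + (two_pi_i / of_real y) ^ Suc k * \<Lambda>'"
      unfolding r_def L_def .
  qed
qed

lemma lambert_series_transform_up_to_residue:
  assumes "even k"
  shows "\<exists>C. \<forall>y>0. lambert_series k f (\<lambda>_. 1) y =
    (if k = 0 then C / of_real y else 0)
    - fact k * of_nat q ^ k / two_pi_i ^ Suc k * dirichlet_L (dft q f) (of_nat (Suc k))
    - two_pi_i ^ Suc k / (of_nat q * of_real y ^ Suc k)
      * lambert_series k (\<lambda>_. 1) (dft q f) (fricke q y)"
proof -
  interpret dft: odd_periodic_seq q "dft q f" by (rule odd_periodic_seq_dft)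
  define L where "L = dirichlet_L (dft q f) (of_nat (Suc k))"
  obtain C where C: "\<forall>y>0. lambert_series k (dft q (dft q f)) (\<lambda>_. 1) y =
    (if k = 0 then C / of_real y else 0) + fact k * (of_nat q / two_pi_i) ^ Suc k * L
    + (two_pi_i / of_real y) ^ Suc k * lambert_series k (\<lambda>_. 1) (dft q f) (fricke q y)"
    using dft.lambert_series_dft_transform [OF assms] unfolding L_def by blast
  show ?thesis
  proof (intro exI allI impI)
    fix y :: real assume y: "y > 0"
    have dft_dft_eq: "dft q (dft q f) = (\<lambda>n. - of_nat q * f n)" by (simp add: dft_dft fun_eq_iff)
    have "lambert_series k (dft q (dft q f)) (\<lambda>_. 1) y = - of_nat q * lambert_series k f (\<lambda>_. 1) y"
      unfolding dft_dft_eq by (rule lambert_series_cmult_left) (simp_all add: Bseq_periodic y)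
    hence "lambert_series k f (\<lambda>_. 1) y =
        - (lambert_series k (dft q (dft q f)) (\<lambda>_. 1) y / of_nat q)"
      using modulus_pos by (simp add: field_simps)
    also have "\<dots> = - ((if k = 0 then C / of_real y else 0) / of_nat q)
        - fact k * ((of_nat q / two_pi_i) ^ Suc k / of_nat q) * L
        - (two_pi_i / of_real y) ^ Suc k / of_nat q
          * lambert_series k (\<lambda>_. 1) (dft q f) (fricke q y)"
      using C y by (simp add: add_divide_distrib del: power_Suc)
    also have "(of_nat q / two_pi_i) ^ Suc k / of_nat q = of_nat q ^ k / two_pi_i ^ Suc k"
      using modulus_pos by (simp add: power_divide)
    also have "(two_pi_i / of_real y) ^ Suc k / of_nat q =
        two_pi_i ^ Suc k / (of_nat q * of_real y ^ Suc k)"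
      by (simp add: power_divide)
    also have "- ((if k = 0 then C / of_real y else 0) / of_nat q) =
        (if k = 0 then - (C / of_nat q) / of_real y else 0)"
      by simp
    finally show "lambert_series k f (\<lambda>_. 1) y = (if k = 0 then - (C / of_nat q) / of_real y else 0)
      - fact k * of_nat q ^ k / two_pi_i ^ Suc k * dirichlet_L (dft q f) (of_nat (Suc k))
      - two_pi_i ^ Suc k / (of_nat q * of_real y ^ Suc k)
        * lambert_series k (\<lambda>_. 1) (dft q f) (fricke q y)"
      by (simp only: L_def times_divide_eq_right)
  qed
qed

end

text \<open>Applying the transformation twice determines its residue in weight one.\<close>

lemma residue_eq_if_fricke_dual:
  fixes F G :: "real \<Rightarrow> complex"
  assumes "q > 0"
    and F: "\<And>y. y > 0 \<Longrightarrow>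
      F y = C / of_real y - L' / two_pi_i - two_pi_i / (of_nat q * of_real y) * G (fricke q y)"
    and G: "\<And>y. y > 0 \<Longrightarrow>
      G y = D / of_real y + of_nat q / two_pi_i * L + two_pi_i / of_real y * F (fricke q y)"
  shows "C = L"
proof -
  have const: "(C - L) / of_real y = L' / two_pi_i + two_pi_i * D / of_real (4 * pi\<^sup>2)"
      if y: "y > 0" for y
  proof -
    define y' where "y' = fricke q y"
    define r where "r = two_pi_i / (of_nat q * of_real y)"
    have y': "y' > 0" "fricke q y' = y" using y assms(1)
      by (simp_all add: y'_def fricke_pos fricke_fricke)
    have "F y = C / of_real y - L' / two_pi_i
        - r * (D / of_real y' + of_nat q / two_pi_i * L + two_pi_i / of_real y' * F y)"
      using F [OF y] G [OF y'(1)] unfolding y'(2) y'_def [symmetric] r_def by simp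
    also have "\<dots> = C / of_real y - L' / two_pi_i - r / of_real y' * D - r * of_nat q / two_pi_i * L
        - r * two_pi_i / of_real y' * F y"
      by (simp add: algebra_simps)
    also have "r * of_nat q / two_pi_i = 1 / of_real y" using assms(1) by (simp add: r_def)
    also have "r / of_real y' = two_pi_i / of_real (4 * pi\<^sup>2)"
      using y assms(1) by (simp add: r_def y'_def fricke_def)
    also have "r * two_pi_i / of_real y' = - 1"
      using y assms(1) by (simp add: r_def y'_def fricke_def power2_eq_square)
    finally show ?thesis by (simp add: diff_divide_distrib algebra_simps)
  qed
  have "(C - L) / of_real 1 = (C - L) / of_real 2"
    unfolding const [OF zero_less_one] const [OF zero_less_numeral] ..
  thus "C = L" by simp
qed

theorem (in odd_periodic_seq) lambert_series_transform:
  assumes "even k" "y > 0"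
  shows "lambert_series k f (\<lambda>_. 1) y =
    (if k = 0 then dirichlet_L f 1 / of_real y else 0)
    - fact k * of_nat q ^ k / two_pi_i ^ Suc k * dirichlet_L (dft q f) (of_nat (Suc k))
    - two_pi_i ^ Suc k / (of_nat q * of_real y ^ Suc k)
      * lambert_series k (\<lambda>_. 1) (dft q f) (fricke q y)"
proof (cases "k = 0")
  case False
  thus ?thesis
    using lambert_series_transform_up_to_residue [OF assms(1)] assms(2) by auto
next
  case True
  define F where "F = lambert_series 0 f (\<lambda>_. 1)"
  define G where "G = lambert_series 0 (dft q f) (\<lambda>_. 1)"
  obtain C where C: "\<And>y. y > 0 \<Longrightarrow> F y = C / of_real y - dirichlet_L (dft q f) 1 / two_pi_i
      - two_pi_i / (of_nat q * of_real y) * G (fricke q y)"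
    using lambert_series_transform_up_to_residue [of 0]
    by (auto simp: F_def G_def lambert_series_0_commute [of "\<lambda>_. 1"])
  moreover obtain D where "\<And>y. y > 0 \<Longrightarrow> G y = D / of_real y + of_nat q / two_pi_i * dirichlet_L f 1
      + two_pi_i / of_real y * F (fricke q y)"
    using lambert_series_dft_transform [of 0]
    by (auto simp: F_def G_def lambert_series_0_commute [of "\<lambda>_. 1"])
  ultimately have "C = dirichlet_L f 1" by (rule residue_eq_if_fricke_dual [OF modulus_pos])
  with C [OF assms(2)] show ?thesis
    unfolding F_def G_def True by (simp add: lambert_series_0_commute [of "\<lambda>_. 1"])
qed

section \<open>Gamma and Bessel integrals\<close>

lemma powr_of_real_eq_exp: "r > 0 \<Longrightarrow> complex_of_real r powr s = exp (s * of_real (ln r))"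
  by (simp add: powr_def Ln_of_real)

definition Gamma_integrand :: "complex \<Rightarrow> real \<Rightarrow> complex" where
  "Gamma_integrand s t = of_real t powr (s - 1) * of_real (exp (- t))"

lemma Gamma_integrand_add_powr:
  fixes e :: real
  assumes "t > 0"
  shows "Gamma_integrand (s + of_real e) t = Gamma_integrand s t * of_real (t powr e)"
proof -
  have "of_real t powr (s + of_real e - 1) = of_real t powr (s - 1) * complex_of_real (t powr e)"
    using assms by (simp add: powr_of_real [symmetric] powr_add [symmetric] algebra_simps)
  thus ?thesis by (simp add: Gamma_integrand_def)
qed

lemma Gamma_integrand_add_nat:
  "t > 0 \<Longrightarrow> Gamma_integrand (s + of_nat j) t = Gamma_integrand s t * of_real t ^ j"
  using Gamma_integrand_add_powr [of t s "real j"] by (simp add: powr_realpow)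

lemma continuous_on_Gamma_integrand: "continuous_on {0<..} (Gamma_integrand s)"
  unfolding Gamma_integrand_def [abs_def] by (intro continuous_intros) auto

lemma absolutely_integrable_Gamma_integrand:
  "Re s > 0 \<Longrightarrow> Gamma_integrand s absolutely_integrable_on {0<..}"
  using absolutely_integrable_Gamma_integral' [of s]
  by (simp add: Gamma_integrand_def [abs_def] exp_minus divide_inverse)

lemma has_integral_Gamma_integrand: "Re s > 0 \<Longrightarrow> (Gamma_integrand s has_integral Gamma s) {0<..}"
  using Gamma_integral_complex' [of s]
  by (simp add: Gamma_integrand_def [abs_def] exp_minus divide_inverse)

lemma has_integral_Gamma_integrand_scaled:
  assumes "Re s > 0" "p > 0"
  shows "((\<lambda>t. p *\<^sub>R Gamma_integrand s (p * t)) has_integral Gamma s) {0<..}"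
proof -
  have "(\<lambda>t. p * t) ` {0<..} = {0<..}"
    using assms(2) by (auto intro!: image_eqI [where x = "_ / p"])
  moreover have "integral {0<..} (Gamma_integrand s) = Gamma s"
    using has_integral_Gamma_integrand [OF assms(1)] by (rule integral_unique)
  ultimately have "(\<lambda>t. \<bar>p\<bar> *\<^sub>R Gamma_integrand s (p * t)) absolutely_integrable_on {0<..} \<and>
      integral {0<..} (\<lambda>t. \<bar>p\<bar> *\<^sub>R Gamma_integrand s (p * t)) = Gamma s"
    using absolutely_integrable_Gamma_integrand [OF assms(1)] assms(2)
      has_absolute_integral_change_of_variables_real
        [of "{0<..}" "\<lambda>t. p * t" "\<lambda>_. p" "Gamma_integrand s" "Gamma s"]
    by (auto simp: inj_on_def intro!: derivative_eq_intros)
  hence "((\<lambda>t. \<bar>p\<bar> *\<^sub>R Gamma_integrand s (p * t)) has_integral Gamma s) {0<..}"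
    by (metis integrable_integral set_lebesgue_integral_eq_integral(1))
  thus ?thesis using assms(2) by simp
qed

lemma integral_Gamma_integrand_exp:
  assumes "Re s > 0" "r \<ge> 0"
  shows "integral {0<..} (\<lambda>t. Gamma_integrand s t * of_real (exp (- (r * t)))) =
    Gamma s / of_real (1 + r) powr s"
proof -
  define p where "p = 1 + r"
  have p: "p > 0" using assms(2) by (simp add: p_def)
  have "((\<lambda>t. p *\<^sub>R Gamma_integrand s (p * t) / of_real p powr s) has_integral
      Gamma s / of_real p powr s) {0<..}"
    by (intro has_integral_divide has_integral_Gamma_integrand_scaled) fact+
  also have "?this \<longleftrightarrow> ((\<lambda>t. Gamma_integrand s t * of_real (exp (- (r * t)))) has_integral
      Gamma s / of_real p powr s) {0<..}"
  proof (rule has_integral_cong)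
    fix t :: real assume "t \<in> {0<..}"
    hence "of_real p * of_real (p * t) powr (s - 1) =
        of_real p powr s * complex_of_real t powr (s - 1)"
      using p by (simp add: powr_times_real powr_diff)
    moreover have "exp (- (p * t)) = exp (- t) * exp (- (r * t))"
      by (simp add: p_def algebra_simps flip: exp_add)
    ultimately show "p *\<^sub>R Gamma_integrand s (p * t) / of_real p powr s =
        Gamma_integrand s t * of_real (exp (- (r * t)))"
      using p by (simp add: Gamma_integrand_def scaleR_conv_of_real mult.assoc [symmetric]
          del: of_real_mult)
        (simp add: mult.assoc)
  qed
  finally show ?thesis unfolding p_def by (rule integral_unique)
qed

lemma absolutely_integrable_Gamma_integrand_powr:
  fixes e :: real
  assumes "Re s + e > 0"
  shows "(\<lambda>t. Gamma_integrand s t * of_real (C * t powr e)) absolutely_integrable_on {0<..}"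
proof -
  have "(\<lambda>t. of_real C * Gamma_integrand (s + of_real e) t) absolutely_integrable_on {0<..}"
    using assms by (intro set_integrable_mult_right absolutely_integrable_Gamma_integrand) simp
  also have "?this \<longleftrightarrow> ?thesis"
    by (intro set_integrable_cong refl) (simp add: Gamma_integrand_add_powr mult_ac)
  finally show ?thesis .
qed

lemma absolutely_integrable_Bessel_integrand:
  assumes "Re \<nu> > 0" "x \<ge> 0"
  shows "(\<lambda>t. Gamma_integrand \<nu> t * of_real (exp (- (x / t)))) absolutely_integrable_on {0<..}"
proof (rule measurable_bounded_by_integrable_imp_absolutely_integrable)
  show "(\<lambda>t. norm (Gamma_integrand \<nu> t)) integrable_on {0<..}"
    using absolutely_integrable_Gamma_integrand [OF assms(1)]
    by (simp only: absolutely_integrable_on_def)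
  show "(\<lambda>t. Gamma_integrand \<nu> t * of_real (exp (- (x / t))))
      \<in> borel_measurable (lebesgue_on {0<..})"
    by (intro continuous_imp_measurable_on_sets_lebesgue continuous_intros
        continuous_on_Gamma_integrand) auto
  show "norm (Gamma_integrand \<nu> t * of_real (exp (- (x / t)))) \<le> norm (Gamma_integrand \<nu> t)"
    if "t \<in> {0<..}" for t
    using that assms(2) by (simp add: norm_mult mult_left_le)
qed simp

lemma integral_UNIV_eq_symmetrized:
  fixes f :: "real \<Rightarrow> 'a :: euclidean_space"
  assumes "f absolutely_integrable_on UNIV"
  shows "integral UNIV f = integral {0..} (\<lambda>s. f s + f (- s))"
proof -
  have right: "f absolutely_integrable_on {0..}" and left: "f absolutely_integrable_on {..0}"
    using assms by (auto intro: set_integrable_subset)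
  have "uminus ` {0::real..} = {..0}" by (auto intro: image_eqI [where x = "- _"])
  moreover have "((\<lambda>s::real. - s) has_real_derivative - 1) (at s within {0..})" for s
    by (auto intro!: derivative_eq_intros)
  ultimately have "(\<lambda>s. \<bar>- 1\<bar> *\<^sub>R f (- s)) absolutely_integrable_on {0..} \<and>
      integral {0..} (\<lambda>s. \<bar>- 1\<bar> *\<^sub>R f (- s)) = integral {..0} f"
    using left has_absolute_integral_change_of_variables_real
      [of "{0..}" uminus "\<lambda>_. -1" f "integral {..0} f"]
    by auto
  hence reflected: "(\<lambda>s. f (- s)) absolutely_integrable_on {0..}"
    "integral {0..} (\<lambda>s. f (- s)) = integral {..0} f" by simp_all
  have "UNIV = {0::real..} \<union> {..0}" by auto
  moreover have "{0::real..} \<inter> {..0} = {0}" by auto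
  ultimately have "integral UNIV f = integral {0..} f + integral {..0} f"
    using right left by (metis integral_Un negligible_sing set_lebesgue_integral_eq_integral(1))
  also have "\<dots> = integral {0..} (\<lambda>s. f s + f (- s))"
    using right reflected by (simp add: integral_add set_lebesgue_integral_eq_integral(1))
  finally show ?thesis .
qed

lemma integral_exp_substitution:
  fixes h :: "real \<Rightarrow> 'a :: euclidean_space"
  assumes "r > 0" and h: "h absolutely_integrable_on {0<..}"
  shows "(\<lambda>s. (r * exp s) *\<^sub>R h (r * exp s)) absolutely_integrable_on UNIV"
    and "integral UNIV (\<lambda>s. (r * exp s) *\<^sub>R h (r * exp s)) = integral {0<..} h"
proof -
  have "range (\<lambda>s. r * exp s) = {0<..}"
  proof (intro equalityI subsetI)
    fix t :: real assume "t \<in> {0<..}"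
    hence "t = r * exp (ln (t / r))" using assms(1) by simp
    thus "t \<in> range (\<lambda>s. r * exp s)" by blast
  qed (use assms(1) in auto)
  moreover have "((\<lambda>s. r * exp s) has_real_derivative r * exp s) (at s)" for s
    by (auto intro!: derivative_eq_intros)
  moreover have "inj (\<lambda>s. r * exp s)" using assms(1) by (simp add: inj_on_def)
  ultimately have "(\<lambda>s. \<bar>r * exp s\<bar> *\<^sub>R h (r * exp s)) absolutely_integrable_on UNIV \<and>
      integral UNIV (\<lambda>s. \<bar>r * exp s\<bar> *\<^sub>R h (r * exp s)) = integral {0<..} h"
    using h by (subst has_absolute_integral_change_of_variables_real) auto
  thus "(\<lambda>s. (r * exp s) *\<^sub>R h (r * exp s)) absolutely_integrable_on UNIV"
    and "integral UNIV (\<lambda>s. (r * exp s) *\<^sub>R h (r * exp s)) = integral {0<..} h"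
    using assms(1) by (simp_all add: abs_mult)
qed

lemma besselK_sqrt:
  assumes "Re \<nu> > 0" "x > 0"
  shows "of_real x powr (\<nu> / 2) * besselK \<nu> (2 * sqrt x) =
    integral {0<..} (\<lambda>t. Gamma_integrand \<nu> t * of_real (exp (- (x / t)))) / 2"
proof -
  define h where "h t = Gamma_integrand \<nu> t * of_real (exp (- (x / t)))" for t
  define r where "r = sqrt x"
  define f where "f s = exp (\<nu> * of_real s) * complex_of_real (exp (- (2 * r) * cosh s))" for s
  have r: "r > 0" "x = r * r" using assms(2) by (simp_all add: r_def)
  have "h absolutely_integrable_on {0<..}"
    unfolding h_def using assms by (intro absolutely_integrable_Bessel_integrand) simp_all
  note substitution = integral_exp_substitution [OF r(1) this]
  have "(r * exp s) *\<^sub>R h (r * exp s) = of_real r powr \<nu> * f s" for s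
  proof -
    define z where "z = complex_of_real (r * exp s)"
    have "exp (- (r * exp s)) * exp (- (x / (r * exp s))) = exp (- (2 * r) * cosh s)"
      using r(1) by (simp add: r(2) cosh_field_def exp_minus field_simps flip: exp_add)
    moreover have "z * z powr (\<nu> - 1) = z powr \<nu>" using r(1) by (simp add: z_def powr_diff)
    moreover have "z powr \<nu> = of_real r powr \<nu> * exp (\<nu> * of_real s)"
      using r(1) by (simp add: z_def powr_of_real_eq_exp ln_mult exp_add distrib_left
          del: of_real_mult)
    ultimately show ?thesis
      unfolding h_def f_def Gamma_integrand_def scaleR_conv_of_real z_def [symmetric]
      by (simp only: mult.assoc flip: of_real_mult) (simp only: mult.assoc [symmetric])
  qed
  with substitution r(1) have f: "f absolutely_integrable_on UNIV"
    "of_real r powr \<nu> * integral UNIV f = integral {0<..} h"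
    by simp_all
  have "f s + f (- s) = 2 * (of_real (exp (- (2 * r) * cosh s)) * cosh (\<nu> * of_real s))" for s
    by (simp add: f_def cosh_field_def algebra_simps)
  with integral_UNIV_eq_symmetrized [OF f(1)] have "integral UNIV f = 2 * besselK \<nu> (2 * r)"
    by (simp add: besselK_def)
  moreover have "of_real r powr \<nu> = complex_of_real x powr (\<nu> / 2)"
    using assms(2) by (simp add: r_def powr_def Ln_of_real ln_sqrt)
  ultimately have "of_real x powr (\<nu> / 2) * (2 * besselK \<nu> (2 * r)) = integral {0<..} h"
    using f(2) by (simp only:)
  thus ?thesis unfolding r_def h_def by (simp add: mult_ac)
qed

lemma besselK_sqrt_mult:
  assumes "Re \<nu> > 0" "N > 0" "\<beta> > 0"
  shows "of_real N powr (\<nu> / 2) * besselK \<nu> (2 * sqrt (N * \<beta>)) =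
    of_real \<beta> powr (- \<nu> / 2) / 2 *
      integral {0<..} (\<lambda>t. Gamma_integrand \<nu> t * of_real (exp (- (N * (\<beta> / t)))))"
proof -
  define I where "I = integral {0<..} (\<lambda>t. Gamma_integrand \<nu> t * of_real (exp (- (N * (\<beta> / t)))))"
  have "of_real \<beta> powr (\<nu> / 2) * (of_real N powr (\<nu> / 2) * besselK \<nu> (2 * sqrt (N * \<beta>))) = I / 2"
    using besselK_sqrt [OF assms(1), of "N * \<beta>"] assms(2,3)
    by (simp add: I_def powr_times_real mult_ac)
  thus ?thesis
    using assms(3) unfolding I_def [symmetric] by (simp add: powr_minus field_simps)
qed

section \<open>Termwise integration\<close>

lemma absolutely_integrable_suminf_dominated:
  fixes F :: "nat \<Rightarrow> 'a :: euclidean_space \<Rightarrow> 'b :: euclidean_space"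
  assumes S: "S \<in> sets lebesgue" and F: "\<And>n. F n \<in> borel_measurable (lebesgue_on S)"
    and G: "G integrable_on S" and c: "summable c"
    and bound: "\<And>n x. x \<in> S \<Longrightarrow> norm (F n x) \<le> c n * G x"
  shows "(\<lambda>x. \<Sum>n. F n x) absolutely_integrable_on S"
    and "(\<lambda>n. integral S (F n)) sums integral S (\<lambda>x. \<Sum>n. F n x)"
proof -
  have "(\<lambda>x. c n * G x) integrable_on S" for n using G by (rule integrable_on_mult_right)
  hence F_abs: "F n absolutely_integrable_on S" for n
    by (rule measurable_bounded_by_integrable_imp_absolutely_integrable [OF F S _ bound])
  hence F_int: "integrable (lebesgue_on S) (F n)" for n
    using S by (intro absolutely_integrable_imp_integrable)
  have norm_eq: "(\<integral>x. norm (F n x) \<partial>lebesgue_on S) = integral S (\<lambda>x. norm (F n x))" for n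
    using F_int S by (intro lebesgue_integral_eq_integral integrable_norm)
  have "integral S (\<lambda>x. norm (F n x)) \<le> c n * integral S G" for n
  proof -
    have "integral S (\<lambda>x. norm (F n x)) \<le> integral S (\<lambda>x. c n * G x)"
      using F_abs [of n] G bound
      by (intro integral_le integrable_on_mult_right) (simp_all add: absolutely_integrable_on_def)
    thus ?thesis by simp
  qed
  hence "norm (\<integral>x. norm (F n x) \<partial>lebesgue_on S) \<le> c n * integral S G" for n
    using F_abs by (simp add: norm_eq integral_nonneg absolutely_integrable_on_def)
  hence "summable (\<lambda>n. \<integral>x. norm (F n x) \<partial>lebesgue_on S)"
    by (rule summable_comparison_test' [OF summable_mult2 [OF c]])
  moreover have "AE x in lebesgue_on S. summable (\<lambda>n. norm (F n x))"
  proof (rule AE_I2)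
    fix x assume "x \<in> space (lebesgue_on S)"
    hence "norm (norm (F n x)) \<le> c n * G x" for n using bound by simp
    thus "summable (\<lambda>n. norm (F n x))"
      by (rule summable_comparison_test' [OF summable_mult2 [OF c]])
  qed
  ultimately have int: "integrable (lebesgue_on S) (\<lambda>x. \<Sum>n. F n x)"
    and sums: "(\<lambda>n. \<integral>x. F n x \<partial>lebesgue_on S) sums (\<integral>x. (\<Sum>n. F n x) \<partial>lebesgue_on S)"
    using F_int by (auto intro: integrable_suminf sums_integral)
  show "(\<lambda>x. \<Sum>n. F n x) absolutely_integrable_on S"
    using int S by (simp add: set_integrable_def integrable_restrict_space)
  show "(\<lambda>n. integral S (F n)) sums integral S (\<lambda>x. \<Sum>n. F n x)"
    using sums S F_int int by (simp add: lebesgue_integral_eq_integral)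
qed

lemma norm_mult_exp_minus_le:
  fixes d h :: complex
  assumes "p > 0" "N > 0" "g > 0"
  shows "norm (d * (h * of_real (exp (- (N * g))))) \<le>
    norm d * N powr (- p) * (p powr p * norm (h * of_real (g powr (- p))))"
proof -
  have "exp (- (N * g)) \<le> p powr p * (N * g) powr (- p)"
    using assms by (intro exp_minus_le_powr) simp_all
  also have "(N * g) powr (- p) = N powr (- p) * g powr (- p)"
    by (rule powr_mult)
  finally have "norm d * (norm h * exp (- (N * g))) \<le>
      norm d * (norm h * (p powr p * (N powr (- p) * g powr (- p))))"
    by (intro mult_left_mono) simp_all
  thus ?thesis by (simp add: norm_mult mult_ac)
qed

lemma integral_lambert_series:
  fixes g :: "real \<Rightarrow> real" and h :: "real \<Rightarrow> complex"
  assumes "Bseq a" "Bseq b" and p: "p > real k + 1"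
    and S: "S \<in> sets lebesgue" "continuous_on S h" "continuous_on S g" "\<And>t. t \<in> S \<Longrightarrow> g t > 0"
    and int: "(\<lambda>t. h t * of_real (g t powr (- p))) absolutely_integrable_on S"
  shows "(\<lambda>t. h t * lambert_series k a b (g t)) absolutely_integrable_on S"
    and "(\<lambda>n. divisor_sum k a b (Suc n)
      * integral S (\<lambda>t. h t * of_real (exp (- (real (Suc n) * g t)))))
      sums integral S (\<lambda>t. h t * lambert_series k a b (g t))"
proof -
  define F where "F n t = divisor_sum k a b (Suc n)
      * (h t * of_real (exp (- (real (Suc n) * g t))))" for n t
  have suminf: "(\<Sum>n. F n t) = h t * lambert_series k a b (g t)" if "t \<in> S" for t
    using sums_mult [OF lambert_series_has_sum(2) [OF assms(1,2) S(4) [OF that], of k], of "h t"]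
    by (simp add: F_def sums_iff mult_ac)
  have F: "F n \<in> borel_measurable (lebesgue_on S)" for n
    unfolding F_def by (intro continuous_imp_measurable_on_sets_lebesgue continuous_intros S(1-3))
  have G: "(\<lambda>t. p powr p * norm (h t * of_real (g t powr (- p)))) integrable_on S"
    using int unfolding absolutely_integrable_on_def by (intro integrable_on_mult_right) blast
  have c: "summable (\<lambda>n. norm (divisor_sum k a b (Suc n)) * real (Suc n) powr (- p))"
    by (rule summable_norm_divisor_sum_powr) fact+
  have bound: "norm (F n t) \<le> norm (divisor_sum k a b (Suc n)) * real (Suc n) powr (- p) *
      (p powr p * norm (h t * of_real (g t powr (- p))))" if "t \<in> S" for n t
    unfolding F_def using p S(4) [OF that] by (intro norm_mult_exp_minus_le) simp_all
  have "(\<lambda>t. \<Sum>n. F n t) absolutely_integrable_on S"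
    by (rule absolutely_integrable_suminf_dominated(1) [OF S(1) F G c bound])
  also have "?this \<longleftrightarrow> (\<lambda>t. h t * lambert_series k a b (g t)) absolutely_integrable_on S"
    by (intro set_integrable_cong refl suminf)
  finally show "(\<lambda>t. h t * lambert_series k a b (g t)) absolutely_integrable_on S" .
  have "(\<lambda>n. integral S (F n)) sums integral S (\<lambda>t. \<Sum>n. F n t)"
    by (rule absolutely_integrable_suminf_dominated(2) [OF S(1) F G c bound])
  also have "integral S (\<lambda>t. \<Sum>n. F n t) = integral S (\<lambda>t. h t * lambert_series k a b (g t))"
    by (intro integral_cong suminf)
  finally show "(\<lambda>n. divisor_sum k a b (Suc n)
      * integral S (\<lambda>t. h t * of_real (exp (- (real (Suc n) * g t)))))
      sums integral S (\<lambda>t. h t * lambert_series k a b (g t))"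
    by (simp add: F_def [abs_def])
qed

lemma divisor_sum_besselK_sums:
  assumes "Bseq a" "Bseq b" "Re \<nu> > 0" "\<beta> > 0"
  shows "(\<lambda>n. divisor_sum k a b (Suc n) * of_nat (Suc n) powr (\<nu> / 2)
      * besselK \<nu> (2 * sqrt (real (Suc n) * \<beta>)))
    sums (of_real \<beta> powr (- \<nu> / 2) / 2 *
      integral {0<..} (\<lambda>t. Gamma_integrand \<nu> t * lambert_series k a b (\<beta> / t)))"
proof -
  define J where "J n = integral {0<..}
      (\<lambda>t. Gamma_integrand \<nu> t * of_real (exp (- (real (Suc n) * (\<beta> / t)))))" for n
  define p where "p = real k + 2"
  have "(\<lambda>t. Gamma_integrand \<nu> t * of_real (\<beta> powr (- p) * t powr p))
      absolutely_integrable_on {0<..}"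
    using assms(3) by (intro absolutely_integrable_Gamma_integrand_powr) (simp add: p_def)
  also have "?this \<longleftrightarrow> (\<lambda>t. Gamma_integrand \<nu> t * of_real ((\<beta> / t) powr (- p)))
      absolutely_integrable_on {0<..}"
    using assms(4) by (intro set_integrable_cong refl) (simp add: powr_divide powr_minus_divide)
  finally have "(\<lambda>n. divisor_sum k a b (Suc n) * J n) sums
      integral {0<..} (\<lambda>t. Gamma_integrand \<nu> t * lambert_series k a b (\<beta> / t))"
    unfolding J_def using assms
    by (intro integral_lambert_series(2) [where p = p])
      (auto simp: p_def intro!: continuous_intros continuous_on_Gamma_integrand)
  hence "(\<lambda>n. of_real \<beta> powr (- \<nu> / 2) / 2 * (divisor_sum k a b (Suc n) * J n)) sums
      (of_real \<beta> powr (- \<nu> / 2) / 2 *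
        integral {0<..} (\<lambda>t. Gamma_integrand \<nu> t * lambert_series k a b (\<beta> / t)))"
    by (rule sums_mult)
  moreover have "of_nat (Suc n) powr (\<nu> / 2) * besselK \<nu> (2 * sqrt (real (Suc n) * \<beta>)) =
      of_real \<beta> powr (- \<nu> / 2) / 2 * J n" for n
    using besselK_sqrt_mult [OF assms(3) _ assms(4), of "real (Suc n)"] by (simp add: J_def)
  ultimately show ?thesis by (simp only: mult.assoc mult.left_commute [of _ "divisor_sum k a b _"])
qed

lemma integral_Gamma_integrand_shifted:
  assumes "Re s > 0" "c > 0" "N \<ge> 0"
  shows "integral {0<..} (\<lambda>t. Gamma_integrand s t * of_real (exp (- (N * (t / c))))) =
    Gamma s * of_real c powr s / of_real (N + c) powr s"
proof -
  have pos: "1 + N / c > 0" using assms by (simp add: add_pos_nonneg)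
  have "N * (t / c) = N / c * t" for t by simp
  with integral_Gamma_integrand_exp [OF assms(1), of "N / c"] assms(2,3)
  have "integral {0<..} (\<lambda>t. Gamma_integrand s t * of_real (exp (- (N * (t / c))))) =
      Gamma s / of_real (1 + N / c) powr s"
    by simp
  also have "\<dots> = Gamma s * of_real c powr s / (of_real c powr s * of_real (1 + N / c) powr s)"
    using assms(2) by simp
  also have "of_real c powr s * of_real (1 + N / c) powr s =
      complex_of_real (c * (1 + N / c)) powr s"
    unfolding of_real_mult using assms(2) pos by (intro powr_times_real [symmetric]) simp_all
  also have "c * (1 + N / c) = N + c" using assms(2) by (simp add: field_simps)
  finally show ?thesis .
qed

lemma divisor_sum_shifted_powr_sums:
  assumes "Bseq a" "Bseq b" "Re s > real k + 1" "c > 0"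
  shows "(\<lambda>t. Gamma_integrand s t * lambert_series k a b (t / c)) absolutely_integrable_on {0<..}"
    and "(\<lambda>n. divisor_sum k a b (Suc n) / of_real (real (Suc n) + c) powr s) sums
      (integral {0<..} (\<lambda>t. Gamma_integrand s t * lambert_series k a b (t / c))
        / (Gamma s * of_real c powr s))"
proof -
  define p where "p = (real k + 1 + Re s) / 2"
  have p: "p > real k + 1" "p < Re s" using assms(3) by (simp_all add: p_def)
  have s: "Re s > 0" using assms(3) by simp
  hence nonzero: "Gamma s * of_real c powr s \<noteq> 0"
    using assms(4) by (auto simp: Gamma_eq_zero_iff elim!: nonpos_Ints_cases)
  have "(\<lambda>t. Gamma_integrand s t * of_real (c powr p * t powr (- p)))
      absolutely_integrable_on {0<..}"
    using p(2) by (intro absolutely_integrable_Gamma_integrand_powr) simp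
  also have "?this \<longleftrightarrow> (\<lambda>t. Gamma_integrand s t * of_real ((t / c) powr (- p)))
      absolutely_integrable_on {0<..}"
    using assms(4) by (intro set_integrable_cong refl) (simp add: powr_divide powr_minus_divide)
  finally have int: "(\<lambda>t. Gamma_integrand s t * of_real ((t / c) powr (- p)))
      absolutely_integrable_on {0<..}" .
  show "(\<lambda>t. Gamma_integrand s t * lambert_series k a b (t / c)) absolutely_integrable_on {0<..}"
    using assms(4)
    by (intro integral_lambert_series(1) [OF assms(1,2) p(1) _ continuous_on_Gamma_integrand _ _ int])
      (simp_all add: continuous_intros)
  have "(\<lambda>n. divisor_sum k a b (Suc n)
      * integral {0<..} (\<lambda>t. Gamma_integrand s t * of_real (exp (- (real (Suc n) * (t / c))))))
      sums integral {0<..} (\<lambda>t. Gamma_integrand s t * lambert_series k a b (t / c))"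
    using assms(4)
    by (intro integral_lambert_series(2) [OF assms(1,2) p(1) _ continuous_on_Gamma_integrand _ _ int])
      (simp_all add: continuous_intros)
  from sums_divide
    [OF this [unfolded integral_Gamma_integrand_shifted [OF s assms(4) of_nat_0_le_iff]],
      of "Gamma s * of_real c powr s"]
  show "(\<lambda>n. divisor_sum k a b (Suc n) / of_real (real (Suc n) + c) powr s) sums
      (integral {0<..} (\<lambda>t. Gamma_integrand s t * lambert_series k a b (t / c))
        / (Gamma s * of_real c powr s))"
    using nonzero by (simp del: of_nat_Suc mult_eq_0_iff)
qed

section \<open>The summation formula\<close>

lemma powr_mult_of_real:
  "x > 0 \<Longrightarrow> y > 0 \<Longrightarrow> complex_of_real (x * y) powr w = of_real x powr w * of_real y powr w"
  by (simp add: powr_times_real)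

lemma powr_divide_of_real:
  "x > 0 \<Longrightarrow> y > 0 \<Longrightarrow> complex_of_real (x / y) powr w = of_real x powr w / of_real y powr w"
  by (simp add: powr_of_real_eq_exp ln_div exp_diff right_diff_distrib del: of_real_divide)

lemma powr_square_of_real: "x > 0 \<Longrightarrow> complex_of_real (x\<^sup>2) powr w = of_real x powr (2 * w)"
  by (simp add: powr_of_real_eq_exp ln_realpow mult_ac del: of_real_power)

lemma powr_quarter_square_mult:
  assumes "a > 0" "x > 0"
  shows "complex_of_real (a\<^sup>2 * x / 4) powr w =
      of_real a powr (2 * w) * of_real x powr w / 2 powr (2 * w)"
proof -
  have "a\<^sup>2 * x / 4 = a\<^sup>2 * x / 2\<^sup>2" by simp
  also have "complex_of_real \<dots> powr w =
      of_real (a\<^sup>2) powr w * of_real x powr w / of_real (2\<^sup>2) powr w"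
    using assms by (simp only: powr_mult_of_real powr_divide_of_real zero_less_power mult_pos_pos
        zero_less_numeral)
  finally show ?thesis
    using assms by (simp only: powr_square_of_real zero_less_numeral of_real_numeral)
qed

lemma two_pi_i_power_Suc_even:
  "even k \<Longrightarrow> two_pi_i ^ Suc k = (-1) ^ (k div 2) * \<i> * (2 * of_real pi) ^ Suc k"
  by (auto simp: power_mult_distrib power_mult elim!: evenE)

lemma inverse_two_pi_i_power_Suc_even:
  assumes "even k"
  shows "inverse (two_pi_i ^ Suc k) = - ((-1) ^ (k div 2) * \<i> / (2 * of_real pi) ^ Suc k)"
proof -
  have "inverse ((-1) ^ (k div 2) :: complex) = (-1) ^ (k div 2)"
    by (cases "even (k div 2)") simp_all
  thus ?thesis
    unfolding two_pi_i_power_Suc_even [OF assms] by (simp add: divide_inverse del: power_Suc)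
qed

lemma powr_scale_dual:
  fixes \<beta> p :: real and q k :: nat and \<nu> :: complex
  assumes "\<beta> > 0" "p > 0" "q > 0"
  shows "of_real \<beta> powr (- \<nu> / 2) * of_real p ^ Suc k / (of_nat q * of_real \<beta> ^ Suc k) *
      of_real (real q * \<beta> / p\<^sup>2) powr (\<nu> + of_nat (Suc k)) =
    of_nat q powr (\<nu> + of_nat k) * of_real \<beta> powr (\<nu> / 2) / of_real p powr (2 * \<nu> + of_nat (Suc k))"
proof -
  define n :: complex where "n = of_nat (Suc k)"
  have pow: "z ^ Suc k = z powr n" if "z \<noteq> 0" for z :: complex
    using that by (simp add: n_def powr_nat' del: of_nat_Suc)
  have "of_real (real q * \<beta> / p\<^sup>2) powr (\<nu> + n) =
      of_nat q powr (\<nu> + n) * of_real \<beta> powr (\<nu> + n) / complex_of_real p powr (2 * (\<nu> + n))"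
    using assms powr_square_of_real [of p "\<nu> + n"] powr_mult_of_real [of "real q" \<beta> "\<nu> + n"]
      powr_divide_of_real [of "real q * \<beta>" "p\<^sup>2" "\<nu> + n"]
    by simp
  also have "of_nat q powr (\<nu> + n) = of_nat q powr (\<nu> + of_nat k) * (of_nat q :: complex)"
    using assms(3) powr_add [of "of_nat q" "\<nu> + of_nat k" 1] by (simp add: n_def add_ac)
  also have "complex_of_real \<beta> powr (\<nu> + n) =
      of_real \<beta> powr (\<nu> / 2) * of_real \<beta> powr (\<nu> / 2) * of_real \<beta> powr n"
    by (simp flip: powr_add)
  also have "of_real p powr (2 * (\<nu> + n)) = of_real p powr (2 * \<nu> + n) * of_real p powr n"
    by (simp flip: powr_add add: algebra_simps)
  finally show ?thesis
    using assms by (simp add: pow powr_minus n_def [symmetric] field_simps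
        del: power_Suc of_nat_Suc)
qed

lemma residue_coefficient_powr:
  fixes \<nu> :: complex
  assumes "a > 0" "x > 0"
  shows "of_real (a\<^sup>2 * x / 4) powr (- \<nu> / 2) / 2 / of_real (a\<^sup>2 * x / 4) =
    2 powr (\<nu> + 1) / of_real a powr (\<nu> + 2) * of_real x powr (- \<nu> / 2 - 1)"
proof -
  have "of_real x powr (- \<nu> / 2 - 1) = of_real x powr (- \<nu> / 2) / (of_real x :: complex)"
    using powr_diff [of "of_real x" "- \<nu> / 2" 1] assms(2) by simp
  thus ?thesis
    using assms unfolding powr_quarter_square_mult [OF assms]
    by (simp add: powr_add powr_minus powr_nat' field_simps power2_eq_square)
qed

lemma constant_coefficient_powr:
  fixes \<nu> :: complex
  assumes "even k" "a > 0" "x > 0"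
  shows "of_real (a\<^sup>2 * x / 4) powr (- \<nu> / 2) / 2 / two_pi_i ^ Suc k =
    - ((-1) ^ (k div 2) * \<i> * of_real x powr (- \<nu> / 2)
      / (of_real a powr \<nu> * 2 powr (of_nat k + 2 - \<nu>) * of_real pi ^ Suc k))"
proof -
  have "of_real (a\<^sup>2 * x / 4) powr (- \<nu> / 2) / 2 / (2 * of_real pi) ^ Suc k =
      of_real x powr (- \<nu> / 2)
        / (of_real a powr \<nu> * 2 powr (of_nat k + 2 - \<nu>) * of_real pi ^ Suc k)"
    using assms(2,3) unfolding powr_quarter_square_mult [OF assms(2,3)]
    by (simp add: powr_add powr_diff powr_minus powr_nat' field_simps power2_eq_square)
  moreover have "of_real (a\<^sup>2 * x / 4) powr (- \<nu> / 2) / 2 / two_pi_i ^ Suc k =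
      - ((-1) ^ (k div 2) * \<i> * 
        (of_real (a\<^sup>2 * x / 4) powr (- \<nu> / 2) / 2 / (2 * of_real pi) ^ Suc k))"
    unfolding divide_inverse [of _ "two_pi_i ^ Suc k"] inverse_two_pi_i_power_Suc_even [OF assms(1)]
    by (simp only: mult_minus_left mult_minus_right divide_inverse mult_ac)
  ultimately show ?thesis by (simp only: times_divide_eq_right)
qed

lemma dual_coefficient_powr:
  fixes \<nu> :: complex
  assumes "even k" "a > 0" "x > 0" "q > 0"
  defines "\<beta> \<equiv> a\<^sup>2 * x / 4"
  shows "of_real \<beta> powr (- \<nu> / 2) / 2 * (two_pi_i ^ Suc k / (of_nat q * of_real \<beta> ^ Suc k))
      * of_real (real q * \<beta> / (4 * pi\<^sup>2)) powr (\<nu> + of_nat k + 1) =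
    (-1) ^ (k div 2) * \<i> * of_real a powr \<nu> * of_nat q powr (\<nu> + of_nat k) * of_real x powr (\<nu> / 2)
      / (2 powr (3 * \<nu> + of_nat k + 2) * of_real pi powr (2 * \<nu> + of_nat k + 1))"
proof -
  define \<epsilon> :: complex where "\<epsilon> = (-1) ^ (k div 2) * \<i>"
  have \<beta>: "\<beta> > 0" using assms by (simp add: \<beta>_def)
  have s: "\<nu> + of_nat k + 1 = \<nu> + of_nat (Suc k)" by simp
  have "of_real \<beta> powr (- \<nu> / 2) / 2 * (two_pi_i ^ Suc k / (of_nat q * of_real \<beta> ^ Suc k))
      * of_real (real q * \<beta> / (4 * pi\<^sup>2)) powr (\<nu> + of_nat k + 1) =
    \<epsilon> / 2 * (of_real \<beta> powr (- \<nu> / 2) * of_real (2 * pi) ^ Suc k / (of_nat q * of_real \<beta> ^ Suc k)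
      * of_real (real q * \<beta> / (2 * pi)\<^sup>2) powr (\<nu> + of_nat (Suc k)))"
    unfolding two_pi_i_power_Suc_even [OF assms(1)] s \<epsilon>_def power_mult_distrib [of 2 pi 2]
    by (simp del: power_Suc of_nat_Suc)
  also have "\<dots> = \<epsilon> / 2 * (of_nat q powr (\<nu> + of_nat k) * of_real \<beta> powr (\<nu> / 2)
      / of_real (2 * pi) powr (2 * \<nu> + of_nat (Suc k)))"
    by (subst powr_scale_dual) (use \<beta> assms(4) in simp_all)
  also have "of_real \<beta> powr (\<nu> / 2) = of_real a powr \<nu> * of_real x powr (\<nu> / 2) / 2 powr \<nu>"
    unfolding \<beta>_def powr_quarter_square_mult [OF assms(2,3)] by simp
  also have "of_real (2 * pi) powr (2 * \<nu> + of_nat (Suc k)) =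
      2 powr (2 * \<nu> + of_nat k + 1) * of_real pi powr (2 * \<nu> + of_nat k + 1)"
    using powr_mult_of_real [of 2 pi "2 * \<nu> + of_nat k + 1"] by (simp add: add_ac)
  finally have "of_real \<beta> powr (- \<nu> / 2) / 2 * (two_pi_i ^ Suc k / (of_nat q * of_real \<beta> ^ Suc k))
      * of_real (real q * \<beta> / (4 * pi\<^sup>2)) powr (\<nu> + of_nat k + 1) =
    \<epsilon> * of_real a powr \<nu> * of_nat q powr (\<nu> + of_nat k) * of_real x powr (\<nu> / 2)
      / (2 * 2 powr \<nu> * 2 powr (2 * \<nu> + of_nat k + 1) * of_real pi powr (2 * \<nu> + of_nat k + 1))"
    by (simp add: mult_ac)
  also have "2 * 2 powr \<nu> * 2 powr (2 * \<nu> + of_nat k + 1) =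
      (2 powr (3 * \<nu> + of_nat k + 2) :: complex)"
    using powr_add [of 2 "\<nu> + 1" "2 * \<nu> + of_nat k + 1"] powr_add [of 2 \<nu> 1]
    by (simp add: algebra_simps)
  finally show ?thesis unfolding \<epsilon>_def .
qed

context odd_periodic_seq
begin

lemma lambert_series_transform_quotient:
  assumes "even k" "\<beta> > 0" "t > 0"
  shows "lambert_series k f (\<lambda>_. 1) (\<beta> / t) =
    (if k = 0 then dirichlet_L f 1 / of_real \<beta> else 0) * of_real t
    - fact k * of_nat q ^ k / two_pi_i ^ Suc k * dirichlet_L (dft q f) (of_nat (Suc k))
    - two_pi_i ^ Suc k / (of_nat q * of_real \<beta> ^ Suc k) * of_real t ^ Suc k
      * lambert_series k (\<lambda>_. 1) (dft q f) (t / (real q * \<beta> / (4 * pi\<^sup>2)))"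
proof -
  have "fricke q (\<beta> / t) = t / (real q * \<beta> / (4 * pi\<^sup>2))"
    using assms(3) by (simp add: fricke_def)
  moreover have "(if k = 0 then dirichlet_L f 1 / of_real (\<beta> / t) else 0) =
      (if k = 0 then dirichlet_L f 1 / of_real \<beta> else 0) * of_real t" by simp
  moreover have "two_pi_i ^ Suc k / (of_nat q * of_real (\<beta> / t) ^ Suc k) =
      two_pi_i ^ Suc k / (of_nat q * of_real \<beta> ^ Suc k) * of_real t ^ Suc k"
    using assms(3) by (simp add: power_divide del: power_Suc)
  moreover have "\<beta> / t > 0" using assms by simp
  ultimately show ?thesis
    using lambert_series_transform [OF assms(1)] by (simp only:)
qed

lemma integral_lambert_series_transform:
  fixes \<nu> :: complex
  assumes "even k" "\<beta> > 0" "Re \<nu> > 0"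
  defines "c \<equiv> real q * \<beta> / (4 * pi\<^sup>2)"
  shows "integral {0<..} (\<lambda>t. Gamma_integrand \<nu> t * lambert_series k f (\<lambda>_. 1) (\<beta> / t)) =
    (if k = 0 then dirichlet_L f 1 / of_real \<beta> else 0) * Gamma (\<nu> + 1)
    - fact k * of_nat q ^ k / two_pi_i ^ Suc k * dirichlet_L (dft q f) (of_nat (Suc k)) * Gamma \<nu>
    - two_pi_i ^ Suc k / (of_nat q * of_real \<beta> ^ Suc k) *
      integral {0<..} (\<lambda>t. Gamma_integrand (\<nu> + of_nat (Suc k)) t
          * lambert_series k (\<lambda>_. 1) (dft q f) (t / c))"
proof -
  define A where "A = (if k = 0 then dirichlet_L f 1 / of_real \<beta> else 0)"
  define B where "B = fact k * of_nat q ^ k / two_pi_i ^ Suc k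
      * dirichlet_L (dft q f) (of_nat (Suc k))"
  define E where "E = two_pi_i ^ Suc k / (of_nat q * of_real \<beta> ^ Suc k)"
  define G where "G t = Gamma_integrand (\<nu> + of_nat (Suc k)) t
      * lambert_series k (\<lambda>_. 1) (dft q f) (t / c)" for t
  have c: "c > 0" using modulus_pos assms(2) by (simp add: c_def)
  have "G absolutely_integrable_on {0<..}"
    unfolding G_def [abs_def] using assms(3) c
    by (intro divisor_sum_shifted_powr_sums(1) Bseq_dft) simp_all
  hence "((\<lambda>t. A * Gamma_integrand (\<nu> + 1) t - B * Gamma_integrand \<nu> t - E * G t) has_integral
      A * Gamma (\<nu> + 1) - B * Gamma \<nu> - E * integral {0<..} G) {0<..}"
    using assms(3) set_lebesgue_integral_eq_integral(1)
    by (intro has_integral_diff has_integral_mult_right has_integral_Gamma_integrand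
        integrable_integral) auto
  also have "?this \<longleftrightarrow> ((\<lambda>t. Gamma_integrand \<nu> t * lambert_series k f (\<lambda>_. 1) (\<beta> / t)) has_integral
      A * Gamma (\<nu> + 1) - B * Gamma \<nu> - E * integral {0<..} G) {0<..}"
  proof (rule has_integral_cong)
    fix t :: real assume "t \<in> {0<..}"
    hence t: "t > 0" by simp
    have "Gamma_integrand (\<nu> + 1) t = Gamma_integrand \<nu> t * of_real t"
      using Gamma_integrand_add_nat [OF t, of \<nu> 1] by simp
    thus "A * Gamma_integrand (\<nu> + 1) t - B * Gamma_integrand \<nu> t - E * G t =
        Gamma_integrand \<nu> t * lambert_series k f (\<lambda>_. 1) (\<beta> / t)"
      unfolding lambert_series_transform_quotient [OF assms(1,2) t] G_def
          Gamma_integrand_add_nat [OF t, of \<nu> "Suc k"]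
      by (simp add: A_def B_def E_def c_def algebra_simps del: power_Suc)
  qed
  finally show ?thesis
    unfolding A_def B_def E_def G_def [abs_def] by (rule integral_unique)
qed

lemma sigma_besselK_sums:
  fixes \<nu> :: complex
  assumes "even k" "\<beta> > 0" "Re \<nu> > 0"
  defines "c \<equiv> real q * \<beta> / (4 * pi\<^sup>2)" and "s \<equiv> \<nu> + of_nat k + 1"
    and "K \<equiv> of_real \<beta> powr (- \<nu> / 2) / 2"
  shows "(\<lambda>n. sigma_chi k f (Suc n) * of_nat (Suc n) powr (\<nu> / 2)
      * besselK \<nu> (2 * sqrt (real (Suc n) * \<beta>))) sums
    ((if k = 0 then 1 else 0) * (K / of_real \<beta>) * Gamma (\<nu> + 1) * dirichlet_L f 1
     - K / two_pi_i ^ Suc k * of_nat q ^ k * Gamma \<nu> * fact k * dirichlet_L (dft q f) (of_nat (Suc k))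
     - K * (two_pi_i ^ Suc k / (of_nat q * of_real \<beta> ^ Suc k)) * of_real c powr s * Gamma s *
      (\<Sum>n. sigma_bar_chi k (dft q f) (Suc n) / of_real (real (Suc n) + c) powr s))"
proof -
  have c: "c > 0" using modulus_pos assms(2) by (simp add: c_def)
  have s: "Re s > real k + 1" using assms(3) by (simp add: s_def)
  have s_eq: "\<nu> + of_nat (Suc k) = s" by (simp add: s_def)
  define r where "r = Gamma s * of_real c powr s"
  have "r \<noteq> 0"
    using c s by (auto simp: r_def Gamma_eq_zero_iff elim!: nonpos_Ints_cases)
  hence dual:
    "integral {0<..} (\<lambda>t. Gamma_integrand s t * lambert_series k (\<lambda>_. 1) (dft q f) (t / c)) =
      r * (\<Sum>n. divisor_sum k (\<lambda>_. 1) (dft q f) (Suc n) / of_real (real (Suc n) + c) powr s)"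
    using sums_unique [OF divisor_sum_shifted_powr_sums(2) [OF _ Bseq_dft s c, of "\<lambda>_. 1"]]
    by (simp add: field_simps del: of_nat_Suc flip: r_def)
  have "(\<lambda>n. divisor_sum k f (\<lambda>_. 1) (Suc n) * of_nat (Suc n) powr (\<nu> / 2)
      * besselK \<nu> (2 * sqrt (real (Suc n) * \<beta>))) sums
    (K * integral {0<..} (\<lambda>t. Gamma_integrand \<nu> t * lambert_series k f (\<lambda>_. 1) (\<beta> / t)))"
    unfolding K_def by (rule divisor_sum_besselK_sums [OF Bseq_periodic _ assms(3,2)]) simp
  thus ?thesis
    unfolding integral_lambert_series_transform [OF assms(1-3), folded c_def] s_eq dual
      sigma_chi_eq_divisor_sum sigma_bar_chi_eq_divisor_sum r_def
    by (cases "k = 0") (simp_all add: algebra_simps del: power_Suc of_nat_Suc)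
qed

theorem sigma_besselK_sums_powr:
  fixes a x :: real and \<nu> :: complex
  assumes "even k" "a > 0" "x > 0" "Re \<nu> > 0"
  shows "(\<lambda>n. sigma_chi k f (Suc n) * of_nat (Suc n) powr (\<nu> / 2)
      * besselK \<nu> (a * sqrt (real (Suc n) * x))) sums
    ((if k = 0 then 1 else 0) * 2 powr (\<nu> + 1) / of_real a powr (\<nu> + 2)
      * Gamma (1 + \<nu>) * dirichlet_L f 1 * of_real x powr (- \<nu> / 2 - 1)
     + (-1) ^ (k div 2) * \<i> * of_nat q ^ k
      / (of_real a powr \<nu> * 2 powr (of_nat k + 2 - \<nu>) * of_real pi ^ Suc k)
      * Gamma \<nu> * Gamma (of_nat k + 1) * dirichlet_L (dft q f) (of_nat k + 1)
      * of_real x powr (- \<nu> / 2)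
     - (-1) ^ (k div 2) * \<i> * of_real a powr \<nu> * of_nat q powr (\<nu> + of_nat k)
       * of_real x powr (\<nu> / 2)
      / (2 powr (3 * \<nu> + of_nat k + 2) * of_real pi powr (2 * \<nu> + of_nat k + 1))
      * Gamma (\<nu> + of_nat k + 1)
      * (\<Sum>n. sigma_bar_chi k (dft q f) (Suc n)
          / of_real (real (Suc n) + a\<^sup>2 * real q * x / (16 * pi\<^sup>2)) powr (\<nu> + of_nat k + 1)))"
proof -
  define \<beta> where "\<beta> = a\<^sup>2 * x / 4"
  define c where "c = real q * \<beta> / (4 * pi\<^sup>2)"
  define s where "s = \<nu> + of_nat k + 1"
  define K where "K = complex_of_real \<beta> powr (- \<nu> / 2) / 2"
  have \<beta>: "\<beta> > 0" using assms by (simp add: \<beta>_def)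
  have c: "c = a\<^sup>2 * real q * x / (16 * pi\<^sup>2)" by (simp add: c_def \<beta>_def)
  have fact: "fact k = (Gamma (of_nat k + 1) :: complex)"
    using Gamma_fact [of k, where 'a = complex] by (simp add: add.commute)
  have "a * sqrt (real n * x) = 2 * sqrt (real n * \<beta>)" for n
    using assms(2) by (simp add: \<beta>_def real_sqrt_mult real_sqrt_divide)
  with sigma_besselK_sums [OF assms(1) \<beta> assms(4)]
  have "(\<lambda>n. sigma_chi k f (Suc n) * of_nat (Suc n) powr (\<nu> / 2)
      * besselK \<nu> (a * sqrt (real (Suc n) * x))) sums
    ((if k = 0 then 1 else 0) * (K / of_real \<beta>) * Gamma (\<nu> + 1) * dirichlet_L f 1
     - K / two_pi_i ^ Suc k * of_nat q ^ k * Gamma \<nu> * fact k * dirichlet_L (dft q f) (of_nat (Suc k))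
     - K * (two_pi_i ^ Suc k / (of_nat q * of_real \<beta> ^ Suc k)) * of_real c powr s * Gamma s *
      (\<Sum>n. sigma_bar_chi k (dft q f) (Suc n) / of_real (real (Suc n) + c) powr s))"
    by (simp only: K_def c_def s_def)
  also have "K / of_real \<beta> = 2 powr (\<nu> + 1) / of_real a powr (\<nu> + 2) * of_real x powr (- \<nu> / 2 - 1)"
    unfolding K_def \<beta>_def by (rule residue_coefficient_powr) fact+
  also have "K / two_pi_i ^ Suc k = - ((-1) ^ (k div 2) * \<i> * of_real x powr (- \<nu> / 2)
      / (of_real a powr \<nu> * 2 powr (of_nat k + 2 - \<nu>) * of_real pi ^ Suc k))"
    unfolding K_def \<beta>_def by (rule constant_coefficient_powr) fact+
  also have "K * (two_pi_i ^ Suc k / (of_nat q * of_real \<beta> ^ Suc k)) * of_real c powr s =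
      (-1) ^ (k div 2) * \<i> * of_real a powr \<nu> * of_nat q powr (\<nu> + of_nat k)
        * of_real x powr (\<nu> / 2)
      / (2 powr (3 * \<nu> + of_nat k + 2) * of_real pi powr (2 * \<nu> + of_nat k + 1))"
    unfolding K_def \<beta>_def c_def s_def by (rule dual_coefficient_powr) (fact assms modulus_pos)+
  finally show ?thesis
    unfolding fact c s_def of_nat_Suc [of k]
    by (simp add: add.commute [of \<nu> 1] add.commute [of 1 "of_nat k"] mult_ac del: power_Suc)
qed

end

theorem theorem2p1:
  fixes k q :: nat and chi :: "nat \<Rightarrow> complex" and a x :: real and \<nu> :: complex
  assumes "even k"
    and "primitive_character q chi" and "odd_character q chi"
    and "a > 0" and "x > 0"
    and "Re \<nu> > 0"
  shows "(\<lambda>m. let n = Suc m in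
            sigma_chi k chi n * of_nat n powr (\<nu> / 2) * besselK \<nu> (a * sqrt (real n * x)))
     sums
      ((if k = 0 then 1 else 0) * 2 powr (\<nu> + 1) / of_real a powr (\<nu> + 2)
          * Gamma (1 + \<nu>) * dirichlet_L chi 1 * of_real x powr (- \<nu> / 2 - 1)
       + (-1) ^ (k div 2) * \<i> * of_nat q ^ k
          / (of_real a powr \<nu> * 2 powr (of_nat k + 2 - \<nu>) * of_real pi ^ (k + 1))
          * Gamma \<nu> * gauss_sum q chi * Gamma (of_nat k + 1)
          * dirichlet_L (\<lambda>n. cnj (chi n)) (of_nat k + 1) * of_real x powr (- \<nu> / 2)
       - (-1) ^ (k div 2) * \<i> * of_real a powr \<nu> * of_nat q powr (\<nu> + of_nat k)
          * of_real x powr (\<nu> / 2)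
          / (2 powr (3 * \<nu> + of_nat k + 2) * of_real pi powr (2 * \<nu> + of_nat k + 1))
          * Gamma (\<nu> + of_nat k + 1) * gauss_sum q chi
          * (\<Sum>m. let n = Suc m in
               sigma_bar_chi k (\<lambda>j. cnj (chi j)) n
               / of_real (real n + a\<^sup>2 * real q * x / (16 * pi\<^sup>2)) powr (\<nu> + of_nat k + 1)))"
proof -
  interpret primitive_char q chi
    using assms(2) by unfold_locales (simp_all add: primitive_character_def)
  interpret odd_periodic_seq q chi
    using assms(3) by (rule odd_periodic_seq_char)
  interpret cnj: odd_periodic_seq q "\<lambda>n. cnj (chi n)"
    by (rule odd_periodic_seq_cnj)
  define \<tau> where "\<tau> = gauss_sum q chi"
  have dft: "dft q chi = (\<lambda>n. \<tau> * cnj (chi n))"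
    by (simp add: dft_primitive_char \<tau>_def)
  have L: "dirichlet_L (dft q chi) (of_nat k + 1) =
      \<tau> * dirichlet_L (\<lambda>n. cnj (chi n)) (of_nat k + 1)"
    using dirichlet_L_eqI
      [OF sums_mult [OF cnj.dirichlet_L_sums [OF assms(1)], of \<tau>, unfolded times_divide_eq_right]]
    by (simp add: dft add.commute)
  define c s where "c = a\<^sup>2 * real q * x / (16 * pi\<^sup>2)" and "s = \<nu> + of_nat k + 1"
  have "c > 0" "Re s > real k + 1" using assms(4-6) modulus_pos by (simp_all add: c_def s_def)
  hence S: "(\<Sum>m. sigma_bar_chi k (dft q chi) (Suc m) / of_real (real (Suc m) + c) powr s) =
      \<tau> * (\<Sum>m. sigma_bar_chi k (\<lambda>n. cnj (chi n)) (Suc m) / of_real (real (Suc m) + c) powr s)"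
    using suminf_mult
      [OF sums_summable [OF divisor_sum_shifted_powr_sums(2) [OF _ cnj.Bseq_periodic]],
        of "\<lambda>_. 1" k s c \<tau>]
    by (simp add: dft sigma_bar_chi_eq_divisor_sum divisor_sum_cmult_right del: of_nat_Suc)
  show ?thesis
    using sigma_besselK_sums_powr [OF assms(1,4-6)]
    unfolding L S [unfolded c_def s_def] Let_def \<tau>_def by (simp only: Suc_eq_plus1 mult_ac)
qed

end
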